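(* Let $M$ be a smooth manifold of dimension $m\ge 3$. If $\nabla$ is a projectively flat, Ricci antisymmetric, torsion free connection on $TM$, then $\nabla$ is flat, i.e. $\mathcal{R}^\nabla=0$. Thus if $V$ is a real vector space of dimension $m\ge 3$ and $0\ne\mathcal{A}\in\mathfrak{A}(V)$ is projectively flat and Ricci antisymmetric, then $\mathcal{A}$ is not geometrically realizable by a projectively flat, Ricci antisymmetric, torsion free connection; that is, there is no projectively flat, Ricci antisymmetric, torsion free connection $\nabla$ on $TV$ with $\mathcal{R}^\nabla_0=\mathcal{A}$.
   Context: A generalized algebraic curvature operator on a real vector space $V$ of dimension $m$ is a tensor $\mathcal{A}\in\otimes^2V^*\otimes\operatorname{End}(V)$ with $\mathcal{A}(x,y)=-\mathcal{A}(y,x)$ and $\mathcal{A}(x,y)z+\mathcal{A}(y,z)x+\mathcal{A}(z,x)y=0$ for all $x,y,z\in V$; $\mathfrak{A}(V)$ is the space of all such operators. The Ricci tensor of $\mathcal{A}$ is $\rho(\mathcal{A})(x,y):=\operatorname{Tr}\{z\mapsto\mathcal{A}(z,x)y\}$, and $\rho_s(\mathcal{A})$, $\rho_a(\mathcal{A})$ denote its symmetric and antisymmetric parts, $\rho_s(\mathcal{A})(x,y)=\frac12\{\rho(\mathcal{A})(x,y)+\rho(\mathcal{A})(y,x)\}$, $\rho_a(\mathcal{A})(x,y)=\frac12\{\rho(\mathcal{A})(x,y)-\rho(\mathcal{A})(y,x)\}$. $\mathcal{A}$ is Ricci antisymmetric if $\rho_s(\mathcal{A})=0$. For $\Theta\in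 V^*\otimes V^*$ define $H(\Theta)\in\mathfrak{A}(V)$ by $H(\Theta)(x,y)z:=\Theta(x,y)z-\Theta(y,x)z+\Theta(x,z)y-\Theta(y,z)x$. Set $\mathcal{P}(\mathcal{A}):=\mathcal{A}+\frac1{m-1}H(\rho_s(\mathcal{A}))+\frac1{1+m}H(\rho_a(\mathcal{A}))$. $\mathcal{A}$ is projectively flat if $\mathcal{P}(\mathcal{A})=0$ or, equivalently, if there exists $\Theta\in V^*\otimes V^*$ with $\mathcal{A}=H(\Theta)$. For a torsion free connection $\nabla$ on $TM$, the curvature operator is $\mathcal{R}^\nabla(x,y):=\nabla_x\nabla_y-\nabla_y\nabla_x-\nabla_{[x,y]}$, and $\mathcal{R}^\nabla_P\in\mathfrak{A}(T_PM)$ denotes its value at $P\in M$. The connection $\nabla$ is projectively flat (resp. Ricci antisymmetric) if $\mathcal{R}^\nabla_P$ is projectively flat (resp. Ricci antisymmetric) for every $P\in M$. When $M=V$ is a vector space, $T_PV$ is identified canonically with $V$. *)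

theory Defs
  imports "HOL-Analysis.Analysis"
begin

section \<open>Generalized algebraic curvature operators\<close>

definition generalized_curvature_operators ::
  "('v::real_vector \<Rightarrow> 'v \<Rightarrow> 'v \<Rightarrow> 'v) set" where
  "generalized_curvature_operators = {A.
     (\<forall>y z. linear (\<lambda>x. A x y z)) \<and>
     (\<forall>x z. linear (\<lambda>y. A x y z)) \<and>
     (\<forall>x y. linear (\<lambda>z. A x y z)) \<and>
     (\<forall>x y z. A x y z = - A y x z) \<and>
     (\<forall>x y z. A x y z + A y z x + A z x y = 0)}"

text \<open>The inner product only serves to read off coordinates with respect to the orthonormal basis
  \<open>Basis\<close>; the trace of a linear map does not depend on it.\<close>

definition linear_trace :: "('v::euclidean_space \<Rightarrow> 'v) \<Rightarrow> real" where
  "linear_trace f = (\<Sum>b\<in>Basis. f b \<bullet> b)"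

definition ricci :: "('v::euclidean_space \<Rightarrow> 'v \<Rightarrow> 'v \<Rightarrow> 'v) \<Rightarrow> 'v \<Rightarrow> 'v \<Rightarrow> real" where
  "ricci A x y = linear_trace (\<lambda>z. A z x y)"

definition ricci_sym :: "('v::euclidean_space \<Rightarrow> 'v \<Rightarrow> 'v \<Rightarrow> 'v) \<Rightarrow> 'v \<Rightarrow> 'v \<Rightarrow> real" where
  "ricci_sym A x y = (ricci A x y + ricci A y x) / 2"

definition ricci_alt :: "('v::euclidean_space \<Rightarrow> 'v \<Rightarrow> 'v \<Rightarrow> 'v) \<Rightarrow> 'v \<Rightarrow> 'v \<Rightarrow> real" where
  "ricci_alt A x y = (ricci A x y - ricci A y x) / 2"

definition ricci_antisymmetric :: "('v::euclidean_space \<Rightarrow> 'v \<Rightarrow> 'v \<Rightarrow> 'v) \<Rightarrow> bool" where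
  "ricci_antisymmetric A \<longleftrightarrow> (\<forall>x y. ricci_sym A x y = 0)"

definition H_op :: "('v::real_vector \<Rightarrow> 'v \<Rightarrow> real) \<Rightarrow> 'v \<Rightarrow> 'v \<Rightarrow> 'v \<Rightarrow> 'v" where
  "H_op \<Theta> x y z = \<Theta> x y *\<^sub>R z - \<Theta> y x *\<^sub>R z + \<Theta> x z *\<^sub>R y - \<Theta> y z *\<^sub>R x"

definition projective_curvature ::
  "('v::euclidean_space \<Rightarrow> 'v \<Rightarrow> 'v \<Rightarrow> 'v) \<Rightarrow> 'v \<Rightarrow> 'v \<Rightarrow> 'v \<Rightarrow> 'v" where
  "projective_curvature A x y z = A x y z
     + (1 / (real DIM('v) - 1)) *\<^sub>R H_op (ricci_sym A) x y z
     + (1 / (1 + real DIM('v))) *\<^sub>R H_op (ricci_alt A) x y z"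

definition projectively_flat :: "('v::euclidean_space \<Rightarrow> 'v \<Rightarrow> 'v \<Rightarrow> 'v) \<Rightarrow> bool" where
  "projectively_flat A \<longleftrightarrow> (\<forall>x y z. projective_curvature A x y z = 0)"


section \<open>Smooth manifolds\<close>

text \<open>Both notions below are meant for open \<open>S\<close>.  As the domain is finite-dimensional, requiring all
  iterated directional derivatives is the same as requiring all iterated Frechet derivatives.\<close>

primrec Ck_on ::
  "nat \<Rightarrow> ('a::euclidean_space \<Rightarrow> 'b::real_normed_vector) \<Rightarrow> 'a set \<Rightarrow> bool" where
  "Ck_on 0 f S \<longleftrightarrow> continuous_on S f"
| "Ck_on (Suc k) f S \<longleftrightarrow>
     (\<forall>x\<in>S. f differentiable (at x)) \<and>
     (\<forall>v. Ck_on k (\<lambda>x. frechet_derivative f (at x) v) S)"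

definition smooth_on ::
  "('a::euclidean_space \<Rightarrow> 'b::real_normed_vector) \<Rightarrow> 'a set \<Rightarrow> bool" where
  "smooth_on f S \<longleftrightarrow> (\<forall>k. Ck_on k f S)"

datatype ('a, 'e) chart = Chart (chart_dom: "'a set") (coord: "'a \<Rightarrow> 'e")

definition param :: "('a, 'e) chart \<Rightarrow> 'e \<Rightarrow> 'a" where
  "param c = inv_into (chart_dom c) (coord c)"

definition chart_image :: "('a, 'e) chart \<Rightarrow> 'e set" where
  "chart_image c = coord c ` chart_dom c"

definition is_chart ::
  "('a::topological_space, 'e::euclidean_space) chart \<Rightarrow> bool" where
  "is_chart c \<longleftrightarrow> open (chart_dom c) \<and> open (chart_image c) \<and>
     homeomorphism (chart_dom c) (chart_image c) (coord c) (param c)"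

definition transition :: "('a, 'e) chart \<Rightarrow> ('a, 'e) chart \<Rightarrow> 'e \<Rightarrow> 'e" where
  "transition c d = coord d \<circ> param c"

text \<open>A smooth manifold is a type of class \<open>t2_space\<close> and \<open>second_countable_topology\<close>
  together with a smooth atlas; its dimension is \<open>DIM('e)\<close>.\<close>

definition smooth_atlas ::
  "('a::{t2_space,second_countable_topology}, 'e::euclidean_space) chart set \<Rightarrow> bool" where
  "smooth_atlas \<A> \<longleftrightarrow>
     (\<forall>c\<in>\<A>. is_chart c) \<and>
     (\<Union>c\<in>\<A>. chart_dom c) = UNIV \<and>
     (\<forall>c\<in>\<A>. \<forall>d\<in>\<A>. smooth_on (transition c d) (coord c ` (chart_dom c \<inter> chart_dom d)))"

definition smooth_function ::
  "('a, 'e::euclidean_space) chart set \<Rightarrow> ('a \<Rightarrow> real) \<Rightarrow> bool" where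
  "smooth_function \<A> f \<longleftrightarrow> (\<forall>c\<in>\<A>. smooth_on (f \<circ> param c) (chart_image c))"

text \<open>Every point \<open>p\<close> gets a reference chart \<open>chart_at \<A> p\<close>, and the tangent space at \<open>p\<close> is identified
  with the model space \<open>'e\<close> by means of the coordinate basis of that chart.  Thus a vector field is a
  function \<open>X :: 'a \<Rightarrow> 'e\<close>, and an element of the tensor bundle over the tangent space at \<open>p\<close> is a
  multilinear map on \<open>'e\<close>.  The reference chart may vary discontinuously with \<open>p\<close>, so smoothness
  of \<open>X\<close> is not smoothness of the function \<open>X\<close>, but smoothness of its components
  \<open>field_rep \<A> c X\<close> with respect to each chart \<open>c\<close>.\<close>

definition chart_at :: "('a, 'e) chart set \<Rightarrow> 'a \<Rightarrow> ('a, 'e) chart" where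
  "chart_at \<A> p = (SOME c. c \<in> \<A> \<and> p \<in> chart_dom c)"

definition field_rep ::
  "('a, 'e::euclidean_space) chart set \<Rightarrow> ('a, 'e) chart \<Rightarrow> ('a \<Rightarrow> 'e) \<Rightarrow> 'e \<Rightarrow> 'e" where
  "field_rep \<A> c X u =
     (let p = param c u; r = chart_at \<A> p
      in frechet_derivative (transition r c) (at (coord r p)) (X p))"

definition vector_field ::
  "('a, 'e::euclidean_space) chart set \<Rightarrow> ('a \<Rightarrow> 'e) \<Rightarrow> bool" where
  "vector_field \<A> X \<longleftrightarrow> (\<forall>c\<in>\<A>. smooth_on (field_rep \<A> c X) (chart_image c))"

definition dir_deriv ::
  "('a, 'e::euclidean_space) chart set \<Rightarrow> ('a \<Rightarrow> 'e) \<Rightarrow> ('a \<Rightarrow> real) \<Rightarrow> 'a \<Rightarrow> real" where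
  "dir_deriv \<A> X f p =
     (let r = chart_at \<A> p in frechet_derivative (f \<circ> param r) (at (coord r p)) (X p))"

text \<open>In the coordinates of \<open>r = chart_at \<A> p\<close>, the components of \<open>X\<close> at \<open>p\<close> are \<open>X p\<close> itself, and
  the bracket is the usual \<open>DY(X) - DX(Y)\<close>.\<close>

definition lie_bracket ::
  "('a, 'e::euclidean_space) chart set \<Rightarrow> ('a \<Rightarrow> 'e) \<Rightarrow> ('a \<Rightarrow> 'e) \<Rightarrow> 'a \<Rightarrow> 'e" where
  "lie_bracket \<A> X Y p =
     (let r = chart_at \<A> p; u = coord r p
      in frechet_derivative (field_rep \<A> r Y) (at u) (X p)
         - frechet_derivative (field_rep \<A> r X) (at u) (Y p))"


section \<open>Connections on the tangent bundle\<close>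

text \<open>A connection is an operator on smooth vector fields; \<open>D X Y\<close> stands for \<open>\<nabla>\<^sub>X Y\<close>, and
  its values on other functions \<open>'a \<Rightarrow> 'e\<close> are irrelevant.\<close>

definition connection ::
  "('a, 'e::euclidean_space) chart set \<Rightarrow> (('a \<Rightarrow> 'e) \<Rightarrow> ('a \<Rightarrow> 'e) \<Rightarrow> 'a \<Rightarrow> 'e) \<Rightarrow> bool" where
  "connection \<A> D \<longleftrightarrow>
     (\<forall>X Y. vector_field \<A> X \<and> vector_field \<A> Y \<longrightarrow> vector_field \<A> (D X Y)) \<and>
     (\<forall>X X' Y. vector_field \<A> X \<and> vector_field \<A> X' \<and> vector_field \<A> Y \<longrightarrow>
        D (\<lambda>p. X p + X' p) Y = (\<lambda>p. D X Y p + D X' Y p)) \<and>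
     (\<forall>f X Y. smooth_function \<A> f \<and> vector_field \<A> X \<and> vector_field \<A> Y \<longrightarrow>
        D (\<lambda>p. f p *\<^sub>R X p) Y = (\<lambda>p. f p *\<^sub>R D X Y p)) \<and>
     (\<forall>X Y Y'. vector_field \<A> X \<and> vector_field \<A> Y \<and> vector_field \<A> Y' \<longrightarrow>
        D X (\<lambda>p. Y p + Y' p) = (\<lambda>p. D X Y p + D X Y' p)) \<and>
     (\<forall>f X Y. smooth_function \<A> f \<and> vector_field \<A> X \<and> vector_field \<A> Y \<longrightarrow>
        D X (\<lambda>p. f p *\<^sub>R Y p) = (\<lambda>p. f p *\<^sub>R D X Y p + dir_deriv \<A> X f p *\<^sub>R Y p))"

definition torsion_free ::
  "('a, 'e::euclidean_space) chart set \<Rightarrow> (('a \<Rightarrow> 'e) \<Rightarrow> ('a \<Rightarrow> 'e) \<Rightarrow> 'a \<Rightarrow> 'e) \<Rightarrow> bool" where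
  "torsion_free \<A> D \<longleftrightarrow>
     (\<forall>X Y. vector_field \<A> X \<and> vector_field \<A> Y \<longrightarrow>
        (\<forall>p. D X Y p - D Y X p = lie_bracket \<A> X Y p))"

definition curvature ::
  "('a, 'e::euclidean_space) chart set \<Rightarrow> (('a \<Rightarrow> 'e) \<Rightarrow> ('a \<Rightarrow> 'e) \<Rightarrow> 'a \<Rightarrow> 'e) \<Rightarrow>
     ('a \<Rightarrow> 'e) \<Rightarrow> ('a \<Rightarrow> 'e) \<Rightarrow> ('a \<Rightarrow> 'e) \<Rightarrow> 'a \<Rightarrow> 'e" where
  "curvature \<A> D X Y Z p =
     D X (D Y Z) p - D Y (D X Z) p - D (lie_bracket \<A> X Y) Z p"

text \<open>The value of the curvature tensor at a point is computed from arbitrary smooth extensions of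
  the three tangent vectors; by tensoriality the choice does not matter.\<close>

definition field_extension ::
  "('a, 'e::euclidean_space) chart set \<Rightarrow> 'a \<Rightarrow> 'e \<Rightarrow> 'a \<Rightarrow> 'e" where
  "field_extension \<A> p x = (SOME X. vector_field \<A> X \<and> X p = x)"

definition curvature_at ::
  "('a, 'e::euclidean_space) chart set \<Rightarrow> (('a \<Rightarrow> 'e) \<Rightarrow> ('a \<Rightarrow> 'e) \<Rightarrow> 'a \<Rightarrow> 'e) \<Rightarrow>
     'a \<Rightarrow> 'e \<Rightarrow> 'e \<Rightarrow> 'e \<Rightarrow> 'e" where
  "curvature_at \<A> D p x y z =
     curvature \<A> D (field_extension \<A> p x) (field_extension \<A> p y) (field_extension \<A> p z) p"

definition projectively_flat_connection ::
  "('a, 'e::euclidean_space) chart set \<Rightarrow> (('a \<Rightarrow> 'e) \<Rightarrow> ('a \<Rightarrow> 'e) \<Rightarrow> 'a \<Rightarrow> 'e) \<Rightarrow> bool" where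
  "projectively_flat_connection \<A> D \<longleftrightarrow> (\<forall>p. projectively_flat (curvature_at \<A> D p))"

definition ricci_antisymmetric_connection ::
  "('a, 'e::euclidean_space) chart set \<Rightarrow> (('a \<Rightarrow> 'e) \<Rightarrow> ('a \<Rightarrow> 'e) \<Rightarrow> 'a \<Rightarrow> 'e) \<Rightarrow> bool" where
  "ricci_antisymmetric_connection \<A> D \<longleftrightarrow> (\<forall>p. ricci_antisymmetric (curvature_at \<A> D p))"

definition flat_connection ::
  "('a, 'e::euclidean_space) chart set \<Rightarrow> (('a \<Rightarrow> 'e) \<Rightarrow> ('a \<Rightarrow> 'e) \<Rightarrow> 'a \<Rightarrow> 'e) \<Rightarrow> bool" where
  "flat_connection \<A> D \<longleftrightarrow>
     (\<forall>X Y Z. vector_field \<A> X \<and> vector_field \<A> Y \<and> vector_field \<A> Z \<longrightarrow>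
        (\<forall>p. curvature \<A> D X Y Z p = 0))"

text \<open>The canonical smooth structure of a vector space \<open>V\<close>.  As its only chart is the identity, the
  identification of tangent spaces with the model space is the canonical identification with \<open>V\<close>.\<close>

definition vector_space_atlas :: "('v, 'v) chart set" where
  "vector_space_atlas = {Chart UNIV id}"

end

theory Submission
  imports Defs
begin

text \<open>
  Ricci antisymmetry and projective flatness determine the curvature from a 2-form:
  \<open>R(X,Y)Z = 2 \<omega>(X,Y) Z + \<omega>(X,Z) Y - \<omega>(Y,Z) X\<close>, where \<open>\<omega>\<close> is a multiple of the Ricci tensor
  (\<open>curvature_at_\<omega>\<close>).  Two classical identities then leave no room for \<open>\<omega>\<close>.

  The second Bianchi identity (\<open>second_bianchi\<close>) becomes, for all fields \<open>W, X, Y, Z\<close>, a linear relation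
  between the vectors \<open>Z, Y, W, X\<close> whose coefficients are values of \<open>\<nabla>\<omega>\<close> (\<open>bianchi_\<Omega>\<close>).  In
  dimension at least 3 there is a vector \<open>Y \<noteq> 0\<close> orthogonal to \<open>W\<close> and \<open>X\<close>; the choice \<open>Z = W\<close> and the
  inner product with \<open>Y\<close> give \<open>(\<nabla>\<^sub>W \<omega>)(X,W) = 0\<close>.  Hence \<open>\<nabla>\<omega>\<close> is totally antisymmetric, and the choice
  \<open>Z = Y\<close> turns the relation into \<open>8 (\<nabla>\<^sub>W \<omega>)(X,Y) Y = 0\<close>.  So \<open>\<omega>\<close> is parallel (\<open>\<Omega>_deriv_zero\<close>).

  Commuting two covariant derivatives of a parallel form shows that the curvature annihilates it:
  \<open>\<omega>(R(U,V)X, Y) + \<omega>(X, R(U,V)Y) = 0\<close> (\<open>curvature_annihilates_\<Omega>\<close>).  For \<open>U = X\<close> and \<open>V = Y\<close> the left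
  side is \<open>6 \<omega>(X,Y)\<^sup>2\<close>.  Therefore \<open>\<omega> = 0\<close> and \<open>R = 0\<close>.

  A connection acts here on global vector fields, whereas the hypotheses concern values of the
  curvature at points.  The bridge consists of bump functions, which localise the coordinate fields of a
  chart (\<open>frame_exists\<close>), and of the resulting fact that function-linear operators are pointwise
  (\<open>tensorial_at\<close>).  The localised frames also show that \<open>\<omega>(X,Y)\<close> is a smooth function, so that it can
  be differentiated (\<open>smooth_\<Omega>\<close>).

  The second part follows from the first: on a vector space the connection would be flat, and its
  curvature at the origin would be zero.
\<close>

section \<open>Calculus of smooth maps\<close>

lemma Ck_on_cong:
  assumes "open S" "\<And>x. x \<in> S \<Longrightarrow> f x = g x" "Ck_on k f S"
  shows "Ck_on k g S"
  using assms(2,3)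
proof (induction k arbitrary: f g)
  case 0
  then show ?case by (simp cong: continuous_on_cong)
next
  case (Suc k)
  have diff: "g differentiable (at x)" if "x \<in> S" for x
    using Suc.prems assms(1) that has_derivative_transform_within_open
    unfolding differentiable_def Ck_on.simps by blast
  have "frechet_derivative f (at x) = frechet_derivative g (at x)" if "x \<in> S" for x
    using Suc.prems assms(1) that by (auto intro!: frechet_derivative_transform_within_open)
  then have "Ck_on k (\<lambda>x. frechet_derivative g (at x) v) S" for v
    using Suc.IH[of "\<lambda>x. frechet_derivative f (at x) v" "\<lambda>x. frechet_derivative g (at x) v"]
      Suc.prems by simp
  with diff show ?case by simp
qed

lemma Ck_on_subset: "Ck_on k f S \<Longrightarrow> T \<subseteq> S \<Longrightarrow> Ck_on k f T"
  by (induction k arbitrary: f) (auto intro: continuous_on_subset)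

lemma Ck_on_local:
  assumes "\<And>x. x \<in> S \<Longrightarrow> \<exists>T. open T \<and> x \<in> T \<and> Ck_on k f T"
  shows "Ck_on k f S"
  using assms
proof (induction k arbitrary: f)
  case 0
  then show ?case
    by (metis Ck_on.simps(1) continuous_at_imp_continuous_on continuous_on_eq_continuous_at)
next
  case (Suc k)
  then show ?case by (simp) meson
qed

lemma Ck_on_Suc_imp: "Ck_on (Suc k) f S \<Longrightarrow> Ck_on k f S"
proof (induction k arbitrary: f)
  case 0
  then show ?case
    by (simp add: continuous_at_imp_continuous_on differentiable_imp_continuous_within)
next
  case (Suc k)
  then show ?case by (metis Ck_on.simps(2))
qed

lemma Ck_on_const: "Ck_on k (\<lambda>x. c) S"
  by (induction k arbitrary: c) auto

lemma Ck_on_ident: "Ck_on k (\<lambda>x. x) S"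
  by (cases k) (auto simp: Ck_on_const)

lemma Ck_on_add:
  assumes "open S" "Ck_on k f S" "Ck_on k g S"
  shows "Ck_on k (\<lambda>x. f x + g x) S"
  using assms(2,3)
proof (induction k arbitrary: f g)
  case 0
  then show ?case by (auto intro: continuous_on_add)
next
  case (Suc k)
  have "frechet_derivative (\<lambda>x. f x + g x) (at x) v
      = frechet_derivative f (at x) v + frechet_derivative g (at x) v" if "x \<in> S" for x v
    using Suc.prems that
    by (subst frechet_derivative_at[of _ "\<lambda>v. frechet_derivative f (at x) v + frechet_derivative g (at x) v", symmetric])
       (auto intro!: has_derivative_add simp flip: frechet_derivative_works)
  moreover have "Ck_on k (\<lambda>x. frechet_derivative f (at x) v + frechet_derivative g (at x) v) S" for v
    using Suc by simp
  ultimately have "Ck_on k (\<lambda>x. frechet_derivative (\<lambda>x. f x + g x) (at x) v) S" for v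
    using Ck_on_cong[OF assms(1)] by (metis (no_types, lifting))
  then show ?case using Suc.prems by simp
qed

lemma Ck_on_sum:
  assumes "open S" "\<And>i. i \<in> I \<Longrightarrow> Ck_on k (f i) S"
  shows "Ck_on k (\<lambda>x. \<Sum>i\<in>I. f i x) S"
  using assms(2)
  by (induction I rule: infinite_finite_induct) (auto simp: Ck_on_const intro!: Ck_on_add assms(1))

lemma (in bounded_bilinear) Ck_on:
  assumes "open S" "Ck_on k f S" "Ck_on k g S"
  shows "Ck_on k (\<lambda>x. prod (f x) (g x)) S"
  using assms(2,3)
proof (induction k arbitrary: f g)
  case 0
  then show ?case by (auto intro: continuous_on)
next
  case (Suc k)
  let ?f' = "\<lambda>x. frechet_derivative f (at x)" and ?g' = "\<lambda>x. frechet_derivative g (at x)"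
  have der: "((\<lambda>x. prod (f x) (g x)) has_derivative
      (\<lambda>v. prod (f x) (?g' x v) + prod (?f' x v) (g x))) (at x)" if "x \<in> S" for x
    using Suc.prems that by (auto intro!: FDERIV simp flip: frechet_derivative_works)
  have "Ck_on k (\<lambda>x. prod (f x) (?g' x v) + prod (?f' x v) (g x)) S" for v
    using Suc.prems Ck_on_Suc_imp[OF Suc.prems(1)] Ck_on_Suc_imp[OF Suc.prems(2)]
    by (intro Ck_on_add assms(1) Suc.IH) auto
  then have "Ck_on k (\<lambda>x. frechet_derivative (\<lambda>x. prod (f x) (g x)) (at x) v) S" for v
    by (rule Ck_on_cong[OF assms(1), rotated]) (simp flip: frechet_derivative_at[OF der])
  then show ?case using der by (auto simp: differentiable_def)
qed

lemma (in bounded_linear) Ck_on: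
  assumes "open S" "Ck_on k g S"
  shows "Ck_on k (\<lambda>x. f (g x)) S"
  using assms(2)
proof (induction k arbitrary: g)
  case 0
  then show ?case by (auto intro: continuous_on)
next
  case (Suc k)
  have der: "((\<lambda>x. f (g x)) has_derivative (\<lambda>v. f (frechet_derivative g (at x) v))) (at x)"
    if "x \<in> S" for x
    using Suc.prems that by (auto intro!: has_derivative simp flip: frechet_derivative_works)
  have "Ck_on k (\<lambda>x. f (frechet_derivative g (at x) v)) S" for v
    using Suc by simp
  then have "Ck_on k (\<lambda>x. frechet_derivative (\<lambda>x. f (g x)) (at x) v) S" for v
    by (rule Ck_on_cong[OF assms(1), rotated]) (simp flip: frechet_derivative_at[OF der])
  then show ?case using der by (auto simp: differentiable_def)
qed

lemma linear_euclidean_expansion: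
  fixes L :: "'a::euclidean_space \<Rightarrow> 'b::real_vector"
  assumes "linear L"
  shows "L v = (\<Sum>b\<in>Basis. (v \<bullet> b) *\<^sub>R L b)"
proof -
  have "L (\<Sum>b\<in>Basis. (v \<bullet> b) *\<^sub>R b) = (\<Sum>b\<in>Basis. (v \<bullet> b) *\<^sub>R L b)"
    using assms by (simp add: linear_sum linear_cmul)
  then show ?thesis by (simp add: euclidean_representation)
qed

text \<open>Expanding the inner derivative in the basis turns the chain rule into a sum of products, each
  of one derivative less than the composition, so that the induction goes through.\<close>

lemma Ck_on_compose:
  fixes g :: "'b::euclidean_space \<Rightarrow> 'c::real_normed_vector" and f :: "'a::euclidean_space \<Rightarrow> 'b"
  assumes "open S" "Ck_on k f S" "Ck_on k g T" "f ` S \<subseteq> T"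
  shows "Ck_on k (\<lambda>x. g (f x)) S"
  using assms(2-4)
proof (induction k arbitrary: f g)
  case 0
  then show ?case by (auto intro: continuous_on_compose2)
next
  case (Suc k)
  let ?f' = "\<lambda>x. frechet_derivative f (at x)" and ?g' = "\<lambda>y. frechet_derivative g (at y)"
  have der: "((\<lambda>x. g (f x)) has_derivative (\<lambda>v. ?g' (f x) (?f' x v))) (at x)" if "x \<in> S" for x
  proof -
    have "f differentiable at x" "g differentiable at (f x)" using Suc.prems that by auto
    then show ?thesis
      using diff_chain_at[of f "?f' x" x g "?g' (f x)"]
      by (simp add: frechet_derivative_works comp_def)
  qed
  have eq: "?g' (f x) (?f' x v) = (\<Sum>b\<in>Basis. (?f' x v \<bullet> b) *\<^sub>R ?g' (f x) b)" if "x \<in> S" for x v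
    using Suc.prems that by (intro linear_euclidean_expansion linear_frechet_derivative) auto
  have "Ck_on k (\<lambda>x. \<Sum>b\<in>Basis. (?f' x v \<bullet> b) *\<^sub>R ?g' (f x) b) S" for v
  proof (intro Ck_on_sum assms(1) bounded_bilinear.Ck_on[OF bounded_bilinear_scaleR])
    fix b :: 'b
    show "Ck_on k (\<lambda>x. ?f' x v \<bullet> b) S"
      using Suc.prems by (intro bounded_linear.Ck_on[OF bounded_linear_inner_left] assms(1)) simp
    show "Ck_on k (\<lambda>x. ?g' (f x) b) S"
      using Suc.prems Ck_on_Suc_imp[OF Suc.prems(1)] Suc.IH[of f "\<lambda>y. ?g' y b"] by simp
  qed
  then have "Ck_on k (\<lambda>x. frechet_derivative (\<lambda>x. g (f x)) (at x) v) S" for v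
    by (rule Ck_on_cong[OF assms(1), rotated]) (simp flip: frechet_derivative_at[OF der] add: eq)
  then show ?case using der by (auto simp: differentiable_def)
qed

lemma Ck_on_inverse:
  fixes f :: "'a::euclidean_space \<Rightarrow> real"
  assumes "open S" "Ck_on k f S" "\<And>x. x \<in> S \<Longrightarrow> f x \<noteq> 0"
  shows "Ck_on k (\<lambda>x. inverse (f x)) S"
  using assms(2)
proof (induction k)
  case 0
  then show ?case using assms by (auto intro: continuous_on_inverse)
next
  case (Suc k)
  let ?f' = "\<lambda>x. frechet_derivative f (at x)"
  have der: "((\<lambda>x. inverse (f x)) has_derivative (\<lambda>v. - (inverse (f x) * ?f' x v * inverse (f x)))) (at x)"
    if "x \<in> S" for x
    using Suc.prems that assms(3) by (auto intro!: has_derivative_inverse simp flip: frechet_derivative_works)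
  have inv: "Ck_on k (\<lambda>x. inverse (f x)) S" using Suc by (blast dest: Ck_on_Suc_imp)
  have "Ck_on k (\<lambda>x. ?f' x v) S" for v using Suc.prems by simp
  then have "Ck_on k (\<lambda>x. - (inverse (f x) * ?f' x v * inverse (f x))) S" for v
    by (intro bounded_linear.Ck_on[OF bounded_linear_minus[OF bounded_linear_ident]]
        bounded_bilinear.Ck_on[OF bounded_bilinear_mult] assms(1) inv)
  then have "Ck_on k (\<lambda>x. frechet_derivative (\<lambda>x. inverse (f x)) (at x) v) S" for v
    using Ck_on_cong[OF assms(1), of _ "\<lambda>x. frechet_derivative (\<lambda>x. inverse (f x)) (at x) v"]
    by (simp flip: frechet_derivative_at[OF der])
  then show ?case using der by (auto simp: differentiable_def)
qed

lemma smooth_on_cong: "open S \<Longrightarrow> (\<And>x. x \<in> S \<Longrightarrow> f x = g x) \<Longrightarrow> smooth_on f S \<Longrightarrow> smooth_on g S"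
  unfolding smooth_on_def using Ck_on_cong by blast

lemma smooth_on_subset: "smooth_on f S \<Longrightarrow> T \<subseteq> S \<Longrightarrow> smooth_on f T"
  unfolding smooth_on_def using Ck_on_subset by blast

lemma smooth_on_local:
  assumes "\<And>x. x \<in> S \<Longrightarrow> \<exists>T. open T \<and> x \<in> T \<and> smooth_on f T"
  shows "smooth_on f S"
  unfolding smooth_on_def using assms Ck_on_local[of S _ f] unfolding smooth_on_def by meson

lemma smooth_on_const: "smooth_on (\<lambda>x. c) S"
  by (simp add: smooth_on_def Ck_on_const)

lemma smooth_on_ident: "smooth_on (\<lambda>x. x) S"
  by (simp add: smooth_on_def Ck_on_ident)

lemma smooth_on_add: "open S \<Longrightarrow> smooth_on f S \<Longrightarrow> smooth_on g S \<Longrightarrow> smooth_on (\<lambda>x. f x + g x) S"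
  by (simp add: smooth_on_def Ck_on_add)

lemma smooth_on_sum: "open S \<Longrightarrow> (\<And>i. i \<in> I \<Longrightarrow> smooth_on (f i) S) \<Longrightarrow> smooth_on (\<lambda>x. \<Sum>i\<in>I. f i x) S"
  by (simp add: smooth_on_def Ck_on_sum)

lemma (in bounded_bilinear) smooth_on:
  "open S \<Longrightarrow> smooth_on f S \<Longrightarrow> smooth_on g S \<Longrightarrow> smooth_on (\<lambda>x. prod (f x) (g x)) S"
  by (simp add: smooth_on_def Ck_on)

lemmas smooth_on_scaleR = bounded_bilinear.smooth_on[OF bounded_bilinear_scaleR]
lemmas smooth_on_mult = bounded_bilinear.smooth_on[OF bounded_bilinear_mult]
lemmas smooth_on_inner = bounded_bilinear.smooth_on[OF bounded_bilinear_inner]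

lemma smooth_on_compose:
  fixes g :: "'b::euclidean_space \<Rightarrow> 'c::real_normed_vector" and f :: "'a::euclidean_space \<Rightarrow> 'b"
  shows "open S \<Longrightarrow> smooth_on f S \<Longrightarrow> smooth_on g T \<Longrightarrow> f ` S \<subseteq> T \<Longrightarrow> smooth_on (\<lambda>x. g (f x)) S"
  unfolding smooth_on_def using Ck_on_compose by blast

lemma smooth_on_inverse:
  fixes f :: "'a::euclidean_space \<Rightarrow> real"
  shows "open S \<Longrightarrow> smooth_on f S \<Longrightarrow> (\<And>x. x \<in> S \<Longrightarrow> f x \<noteq> 0) \<Longrightarrow> smooth_on (\<lambda>x. inverse (f x)) S"
  by (simp add: smooth_on_def Ck_on_inverse)

lemma smooth_on_imp_differentiable: "smooth_on f S \<Longrightarrow> x \<in> S \<Longrightarrow> f differentiable (at x)"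
  unfolding smooth_on_def by (metis Ck_on.simps(2))

lemma smooth_on_has_derivative:
  "smooth_on f S \<Longrightarrow> x \<in> S \<Longrightarrow> (f has_derivative frechet_derivative f (at x)) (at x)"
  using smooth_on_imp_differentiable frechet_derivative_works by blast

lemma smooth_on_imp_continuous_on: "smooth_on f S \<Longrightarrow> continuous_on S f"
  unfolding smooth_on_def by (metis Ck_on.simps(1))

lemma smooth_on_directional: "smooth_on f S \<Longrightarrow> smooth_on (\<lambda>x. frechet_derivative f (at x) v) S"
  unfolding smooth_on_def by (metis Ck_on.simps(2))

text \<open>The direction may vary with the point: expanding it in the basis reduces this to the derivatives
  in constant directions, of which the definition of smoothness speaks.\<close>

lemma smooth_on_frechet_derivative:
  fixes v :: "'a::euclidean_space \<Rightarrow> 'a"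
  assumes "open S" "smooth_on f S" "smooth_on v S"
  shows "smooth_on (\<lambda>x. frechet_derivative f (at x) (v x)) S"
proof -
  have "smooth_on (\<lambda>x. \<Sum>b\<in>Basis. (v x \<bullet> b) *\<^sub>R frechet_derivative f (at x) b) S"
    by (intro smooth_on_sum smooth_on_scaleR smooth_on_directional smooth_on_inner smooth_on_const assms)
  then show ?thesis
    by (rule smooth_on_cong[OF assms(1), rotated])
       (rule linear_euclidean_expansion[OF linear_frechet_derivative
          [OF smooth_on_imp_differentiable[OF assms(2)]], symmetric])
qed

subsection \<open>Symmetry of second derivatives\<close>

text \<open>One mean value theorem in the direction \<open>v\<close>, for the increment of \<open>f\<close> by \<open>h w\<close>, and one in the
  direction \<open>w\<close>, for the derivative along \<open>v\<close>.\<close>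

lemma second_difference_mean_value:
  fixes f :: "'a::euclidean_space \<Rightarrow> real"
  assumes f: "smooth_on f (ball x r)" and h: "h > 0" "h * (norm v + norm w) < r"
  shows "\<exists>s t. 0 < s \<and> s < h \<and> 0 < t \<and> t < h \<and>
    f (x + h *\<^sub>R v + h *\<^sub>R w) - f (x + h *\<^sub>R v) - f (x + h *\<^sub>R w) + f x
      = h * h * frechet_derivative (\<lambda>y. frechet_derivative f (at y) v) (at (x + s *\<^sub>R v + t *\<^sub>R w)) w"
proof -
  have inball: "x + s *\<^sub>R v + t *\<^sub>R w \<in> ball x r" if "0 \<le> s" "s \<le> h" "0 \<le> t" "t \<le> h" for s t
  proof -
    have "norm (s *\<^sub>R v + t *\<^sub>R w) \<le> s * norm v + t * norm w"
      using that norm_triangle_ineq[of "s *\<^sub>R v" "t *\<^sub>R w"] by simp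
    also have "\<dots> \<le> h * norm v + h * norm w"
      using that by (intro add_mono mult_right_mono) auto
    also have "\<dots> < r" using h by (simp add: algebra_simps)
    finally have "dist (x + (s *\<^sub>R v + t *\<^sub>R w)) x < r" by (simp add: dist_norm)
    then show ?thesis by (simp add: dist_commute add.assoc)
  qed
  let ?F = "\<lambda>y. frechet_derivative f (at y) v"
  have line: "((\<lambda>s. g (a + s *\<^sub>R u)) has_real_derivative frechet_derivative g (at (a + s *\<^sub>R u)) u) (at s)"
    if "g differentiable at (a + s *\<^sub>R u)" for g :: "'a \<Rightarrow> real" and a u s
  proof -
    have "((\<lambda>s. a + s *\<^sub>R u) has_derivative (\<lambda>t. t *\<^sub>R u)) (at s)"
      by (auto intro!: derivative_eq_intros)
    from diff_chain_at[OF this] that have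
      "((\<lambda>s. g (a + s *\<^sub>R u)) has_derivative (\<lambda>t. frechet_derivative g (at (a + s *\<^sub>R u)) (t *\<^sub>R u))) (at s)"
      by (auto simp: frechet_derivative_works comp_def)
    then show ?thesis
      using linear_cmul[OF linear_frechet_derivative[OF that]]
      by (simp add: has_field_derivative_def mult.commute[of _ "frechet_derivative _ _ _"])
  qed
  define \<phi> where "\<phi> s = f (x + h *\<^sub>R w + s *\<^sub>R v) - f (x + s *\<^sub>R v)" for s
  have "(\<phi> has_real_derivative (?F (x + h *\<^sub>R w + s *\<^sub>R v) - ?F (x + s *\<^sub>R v))) (at s)"
    if "0 \<le> s" "s \<le> h" for s
    unfolding \<phi>_def using that h inball[of s h] inball[of s 0]
    by (intro DERIV_diff line smooth_on_imp_differentiable[OF f]) (auto simp: algebra_simps)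
  from MVT2[OF h(1) this] obtain s where s: "0 < s" "s < h"
    "\<phi> h - \<phi> 0 = h * (?F (x + h *\<^sub>R w + s *\<^sub>R v) - ?F (x + s *\<^sub>R v))" by auto
  have "((\<lambda>t. ?F (x + s *\<^sub>R v + t *\<^sub>R w)) has_real_derivative
      frechet_derivative ?F (at (x + s *\<^sub>R v + t *\<^sub>R w)) w) (at t)"
    if "0 \<le> t" "t \<le> h" for t
    using that s inball[of s t]
    by (intro line smooth_on_imp_differentiable[OF smooth_on_directional[OF f]]) auto
  from MVT2[OF h(1) this] obtain t where t: "0 < t" "t < h"
    "?F (x + s *\<^sub>R v + h *\<^sub>R w) - ?F (x + s *\<^sub>R v + 0 *\<^sub>R w)
      = h * frechet_derivative ?F (at (x + s *\<^sub>R v + t *\<^sub>R w)) w" by auto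
  have "\<phi> h - \<phi> 0 = h * h * frechet_derivative ?F (at (x + s *\<^sub>R v + t *\<^sub>R w)) w"
    using s(3) t(3) by (simp add: algebra_simps)
  then have "f (x + h *\<^sub>R v + h *\<^sub>R w) - f (x + h *\<^sub>R v) - f (x + h *\<^sub>R w) + f x
      = h * h * frechet_derivative ?F (at (x + s *\<^sub>R v + t *\<^sub>R w)) w"
    by (simp add: \<phi>_def algebra_simps)
  with s(1,2) t(1,2) show ?thesis by blast
qed

text \<open>Both mixed derivatives are limits of the same second difference quotient.\<close>

lemma symmetric_second_derivative:
  fixes f :: "'a::euclidean_space \<Rightarrow> real"
  assumes "open S" "x \<in> S" "smooth_on f S"
  shows "frechet_derivative (\<lambda>y. frechet_derivative f (at y) v) (at x) w
       = frechet_derivative (\<lambda>y. frechet_derivative f (at y) w) (at x) v"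
proof (rule ccontr)
  define G where "G v w y = frechet_derivative (\<lambda>y. frechet_derivative f (at y) v) (at y) w" for v w y
  assume "\<not> ?thesis"
  then have ne: "\<bar>G v w x - G w v x\<bar> / 2 > 0" (is "?e > 0") by (simp add: G_def)
  obtain r where r: "r > 0" "ball x r \<subseteq> S" using assms by (meson open_contains_ball)
  have cont: "\<exists>d>0. \<forall>y. dist y x < d \<longrightarrow> dist (G v w y) (G v w x) < ?e" for v w
  proof -
    have "continuous_on S (G v w)"
      unfolding G_def by (intro smooth_on_imp_continuous_on smooth_on_directional assms(3))
    then have "isCont (G v w) x" using assms by (simp add: continuous_on_eq_continuous_at)
    then show ?thesis using ne unfolding continuous_at_eps_delta by blast
  qed
  obtain d1 where d1: "d1 > 0" "\<And>y. dist y x < d1 \<Longrightarrow> dist (G v w y) (G v w x) < ?e" using cont by blast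
  obtain d2 where d2: "d2 > 0" "\<And>y. dist y x < d2 \<Longrightarrow> dist (G w v y) (G w v x) < ?e" using cont by blast
  define d where "d = min r (min d1 d2)"
  have d: "d > 0" using r d1 d2 by (simp add: d_def)
  define h where "h = d / (norm v + norm w + 1)"
  have pos: "norm v + norm w + 1 > 0" by (simp add: add_nonneg_pos)
  have h: "h > 0" "h * (norm v + norm w) < d"
    using d pos by (auto simp: h_def divide_simps mult_less_cancel_left)
  have f: "smooth_on f (ball x d)" using r(2) by (auto intro!: smooth_on_subset[OF assms(3)] simp: d_def)
  have near: "dist (x + s *\<^sub>R a + t *\<^sub>R b) x < d"
    if "0 < s" "s < h" "0 < t" "t < h" "{a, b} = {v, w}" for s t a b
  proof -
    have "norm (s *\<^sub>R a + t *\<^sub>R b) \<le> s * norm a + t * norm b"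
      using that norm_triangle_ineq[of "s *\<^sub>R a" "t *\<^sub>R b"] by simp
    also have "\<dots> \<le> h * norm a + h * norm b"
      using that by (intro add_mono mult_right_mono) auto
    also have "\<dots> = h * (norm v + norm w)" using that(5) by (auto simp: doubleton_eq_iff algebra_simps)
    finally show ?thesis using h(2) by (simp add: dist_norm add.assoc)
  qed
  obtain s t where st: "0 < s" "s < h" "0 < t" "t < h"
    "f (x + h *\<^sub>R v + h *\<^sub>R w) - f (x + h *\<^sub>R v) - f (x + h *\<^sub>R w) + f x
      = h * h * G v w (x + s *\<^sub>R v + t *\<^sub>R w)"
    using second_difference_mean_value[OF f h] unfolding G_def by blast
  obtain s' t' where st': "0 < s'" "s' < h" "0 < t'" "t' < h"
    "f (x + h *\<^sub>R w + h *\<^sub>R v) - f (x + h *\<^sub>R w) - f (x + h *\<^sub>R v) + f x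
      = h * h * G w v (x + s' *\<^sub>R w + t' *\<^sub>R v)"
    using second_difference_mean_value[OF f h(1), of w v] h(2) unfolding G_def by (metis add.commute)
  have "h * h * G v w (x + s *\<^sub>R v + t *\<^sub>R w) = h * h * G w v (x + s' *\<^sub>R w + t' *\<^sub>R v)"
    using st(5) st'(5) by (simp add: algebra_simps)
  then have "G v w (x + s *\<^sub>R v + t *\<^sub>R w) = G w v (x + s' *\<^sub>R w + t' *\<^sub>R v)" using h by simp
  moreover have "dist (G v w (x + s *\<^sub>R v + t *\<^sub>R w)) (G v w x) < ?e"
    using near[OF st(1-4)] by (intro d1) (auto simp: d_def)
  moreover have "dist (G w v (x + s' *\<^sub>R w + t' *\<^sub>R v)) (G w v x) < ?e"
    using near[OF st'(1-4)] by (intro d2) (auto simp: d_def insert_commute)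
  moreover have False if "\<bar>c - p\<bar> < \<bar>p - q\<bar> / 2" "\<bar>c - q\<bar> < \<bar>p - q\<bar> / 2" for c p q :: real
    using that by (auto simp: abs_if split: if_splits)
  ultimately show False unfolding dist_real_def by metis
qed

subsection \<open>Bump functions\<close>

text \<open>The functions \<open>exp (-1/t) / t\<^sup>n\<close>, extended by zero, are closed under differentiation up to linear
  combinations.  Hence all of them are treated in one induction on the order of differentiability.\<close>

lemma flat_exponential_smooth:
  "smooth_on (\<lambda>t::real. if t > 0 then exp (- inverse t) * inverse t ^ n else 0) UNIV"
proof -
  define g where "g n t = (if t > 0 then exp (- inverse t) * inverse t ^ n else 0)" for n and t :: real
  \<comment> \<open>A difference quotient of \<open>g n\<close> at 0 is a value of \<open>g (n + 1)\<close>, so these limits also give the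
    derivatives at 0.\<close>
  have lim: "((\<lambda>t. g n t) \<longlongrightarrow> 0) (at 0)" for n
  proof -
    have "((\<lambda>t. exp (- inverse t) * inverse t ^ n) \<longlongrightarrow> 0) (at_right (0::real))"
    proof -
      have "((\<lambda>s. s ^ n / exp s) \<longlongrightarrow> 0) (at_top :: real filter)" by (rule tendsto_power_div_exp_0)
      from filterlim_compose[OF this filterlim_inverse_at_top_right] show ?thesis
        by (simp add: exp_minus divide_inverse mult.commute)
    qed
    then have "(g n \<longlongrightarrow> 0) (at_right 0)"
      by (rule Lim_transform_eventually)
         (auto simp: g_def eventually_at_right_field intro!: exI[of _ 1])
    moreover have "(g n \<longlongrightarrow> 0) (at_left 0)"
      by (rule Lim_transform_eventually[OF tendsto_const])
         (auto simp: g_def eventually_at_left_field intro!: exI[of _ "-1"])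
    ultimately show ?thesis by (simp add: filterlim_split_at)
  qed
  have der: "(g n has_real_derivative (g (n + 2) t - real n * g (n + 1) t)) (at t)" for n t
  proof (cases "t = 0")
    case True
    have "((\<lambda>h. (g n (0 + h) - g n 0) / h) \<longlongrightarrow> 0) (at 0)"
      using lim[of "n + 1"] by (rule Lim_transform_eventually)
        (auto simp: g_def divide_inverse mult_ac intro!: eventuallyI)
    then have "(g n has_real_derivative 0) (at 0)" by (simp add: DERIV_def)
    with True show ?thesis by (simp add: g_def)
  next
    case False
    show ?thesis
    proof (cases "t > 0")
      case True
      have "((\<lambda>t. exp (- inverse t) * inverse t ^ n) has_real_derivative
          (g (n + 2) t - real n * g (n + 1) t)) (at t)"
        using True
        by (auto intro!: derivative_eq_intros simp: g_def power2_eq_square field_simps)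
           (cases n; auto simp: field_simps)
      then show ?thesis
        by (rule has_field_derivative_transform_within_open[of _ _ _ "{0<..}"]) (use True in \<open>auto simp: g_def\<close>)
    next
      case False
      with \<open>t \<noteq> 0\<close> have "t < 0" by simp
      have "((\<lambda>t. 0) has_real_derivative (g (n + 2) t - real n * g (n + 1) t)) (at t)"
        using \<open>t < 0\<close> by (simp add: g_def)
      then show ?thesis
        by (rule has_field_derivative_transform_within_open[of _ _ _ "{..<0}"]) (use \<open>t < 0\<close> in \<open>auto simp: g_def\<close>)
    qed
  qed
  have fre: "frechet_derivative (g n) (at t) = (\<lambda>v. (g (n + 2) t - real n * g (n + 1) t) * v)" for n t
    using der[of n t] unfolding has_field_derivative_def by (simp flip: frechet_derivative_at)
  have "Ck_on k (g n) UNIV" for k n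
  proof (induction k arbitrary: n)
    case 0
    show ?case using der by (auto intro!: DERIV_continuous_on)
  next
    case (Suc k)
    have "Ck_on k (\<lambda>t. (g (n + 2) t + (- real n) * g (n + 1) t) * v) UNIV" for v
      by (intro bounded_bilinear.Ck_on[OF bounded_bilinear_mult] Ck_on_add Ck_on_const Suc.IH) auto
    moreover have "g n differentiable (at t)" for t
      using der real_differentiable_def by blast
    ultimately show ?case by (simp add: fre)
  qed
  then have "smooth_on (g n) UNIV" by (simp add: smooth_on_def)
  then show ?thesis by (simp only: g_def[abs_def])
qed

lemma bump_function_exists:
  fixes u :: "'a::euclidean_space"
  assumes "r > 0"
  obtains \<psi> :: "'a \<Rightarrow> real"
  where "smooth_on \<psi> UNIV" "\<psi> u = 1" "\<And>x. x \<notin> ball u r \<Longrightarrow> \<psi> x = 0"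
proof -
  define g where "g t = (if t > 0 then exp (- inverse t) * inverse t ^ 0 else 0)" for t :: real
  define \<psi> where "\<psi> x = g (r ^ 2 + (-1) * ((x + - u) \<bullet> (x + - u))) * inverse (g (r ^ 2))" for x
  have "g (r ^ 2) > 0" using assms by (simp add: g_def)
  have "smooth_on g UNIV" using flat_exponential_smooth[of 0] by (simp only: g_def[abs_def])
  moreover have "smooth_on (\<lambda>x. r ^ 2 + (-1) * ((x + - u) \<bullet> (x + - u))) UNIV"
    by (intro smooth_on_add smooth_on_mult smooth_on_inner smooth_on_const smooth_on_ident open_UNIV)
  ultimately have "smooth_on (\<lambda>x. g (r ^ 2 + (-1) * ((x + - u) \<bullet> (x + - u)))) UNIV"
    using smooth_on_compose[of UNIV _ g UNIV] by blast
  from smooth_on_mult[OF open_UNIV this smooth_on_const[of "inverse (g (r ^ 2))"]]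
  have "smooth_on \<psi> UNIV" by (simp only: \<psi>_def[abs_def])
  moreover have "\<psi> u = 1" using \<open>g (r ^ 2) > 0\<close> by (simp add: \<psi>_def)
  moreover have "\<psi> x = 0" if "x \<notin> ball u r" for x
  proof -
    have "r \<le> norm (x - u)" using that by (simp add: dist_norm norm_minus_commute)
    then have "r ^ 2 \<le> norm (x - u) ^ 2" using assms by (intro power_mono) auto
    then show ?thesis by (simp add: \<psi>_def g_def power2_norm_eq_inner)
  qed
  ultimately show thesis using that by blast
qed

section \<open>Smooth manifolds\<close>

locale smooth_manifold =
  fixes \<A> :: "('a::{t2_space,second_countable_topology}, 'e::euclidean_space) chart set"
  assumes atlas: "smooth_atlas \<A>"
begin

abbreviation chart_for :: "'a \<Rightarrow> ('a, 'e) chart" where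
  "chart_for p \<equiv> chart_at \<A> p"

lemma chart_at_in_atlas: "chart_for p \<in> \<A>"
  and chart_at_dom: "p \<in> chart_dom (chart_for p)"
proof -
  have "p \<in> (\<Union>c\<in>\<A>. chart_dom c)" using atlas by (simp add: smooth_atlas_def)
  then have "\<exists>c. c \<in> \<A> \<and> p \<in> chart_dom c" by blast
  from someI_ex[OF this] show "chart_for p \<in> \<A>" "p \<in> chart_dom (chart_for p)"
    by (auto simp: chart_at_def)
qed

lemma chart_homeomorphism:
  assumes "c \<in> \<A>"
  shows "homeomorphism (chart_dom c) (chart_image c) (coord c) (param c)"
    and open_chart_dom: "open (chart_dom c)" and open_chart_image: "open (chart_image c)"
  using assms atlas by (auto simp: smooth_atlas_def is_chart_def)

lemma param_coord [simp]: "c \<in> \<A> \<Longrightarrow> p \<in> chart_dom c \<Longrightarrow> param c (coord c p) = p"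
  using chart_homeomorphism homeomorphism_apply1 by blast

lemma coord_param [simp]: "c \<in> \<A> \<Longrightarrow> u \<in> chart_image c \<Longrightarrow> coord c (param c u) = u"
  using chart_homeomorphism homeomorphism_apply2 by blast

lemma param_in_dom [simp]: "c \<in> \<A> \<Longrightarrow> u \<in> chart_image c \<Longrightarrow> param c u \<in> chart_dom c"
  using chart_homeomorphism homeomorphism_image2 by blast

lemma coord_in_image [simp]: "p \<in> chart_dom c \<Longrightarrow> coord c p \<in> chart_image c"
  by (simp add: chart_image_def)

lemma open_param_vimage:
  assumes "c \<in> \<A>" "open U"
  shows "open {u \<in> chart_image c. param c u \<in> U}"
proof -
  have "continuous_on (chart_image c) (param c)"
    using chart_homeomorphism[OF assms(1)] homeomorphism_cont2 by blast
  from continuous_open_preimage[OF this open_chart_image[OF assms(1)] assms(2)]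
  show ?thesis by (simp add: vimage_def Int_def)
qed

lemma overlap_eq:
  assumes "c \<in> \<A>"
  shows "coord c ` (chart_dom c \<inter> chart_dom d) = {u \<in> chart_image c. param c u \<in> chart_dom d}"
  using assms by (auto simp: image_iff) (metis IntI coord_param param_in_dom)

text \<open>The domain of the change of coordinates from \<open>c\<close> to \<open>d\<close>, described by \<open>param\<close> instead of as an
  image under \<open>coord\<close>, which makes its openness and membership in it immediate.\<close>

definition overlap :: "('a, 'e) chart \<Rightarrow> ('a, 'e) chart \<Rightarrow> 'e set" where
  "overlap c d = {u \<in> chart_image c. param c u \<in> chart_dom d}"

lemma overlap_iff: "u \<in> overlap c d \<longleftrightarrow> u \<in> chart_image c \<and> param c u \<in> chart_dom d"
  by (simp add: overlap_def)

lemma coord_in_overlap: "c \<in> \<A> \<Longrightarrow> p \<in> chart_dom c \<Longrightarrow> p \<in> chart_dom d \<Longrightarrow> coord c p \<in> overlap c d"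
  by (simp add: overlap_iff)

lemma open_overlap: "c \<in> \<A> \<Longrightarrow> d \<in> \<A> \<Longrightarrow> open (overlap c d)"
  by (simp add: overlap_def open_param_vimage open_chart_dom)

lemma smooth_transition: "c \<in> \<A> \<Longrightarrow> d \<in> \<A> \<Longrightarrow> smooth_on (transition c d) (overlap c d)"
  using atlas by (simp add: smooth_atlas_def overlap_eq overlap_def)

lemma transition_in_overlap:
  "c \<in> \<A> \<Longrightarrow> d \<in> \<A> \<Longrightarrow> u \<in> overlap c d \<Longrightarrow> transition c d u \<in> overlap d c"
  by (simp add: overlap_iff transition_def)

lemma param_transition:
  "c \<in> \<A> \<Longrightarrow> d \<in> \<A> \<Longrightarrow> u \<in> overlap c d \<Longrightarrow> param d (transition c d u) = param c u"
  by (simp add: overlap_iff transition_def)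

lemma transition_coord: "c \<in> \<A> \<Longrightarrow> p \<in> chart_dom c \<Longrightarrow> transition c d (coord c p) = coord d p"
  by (simp add: transition_def)

text \<open>The identity of the tangent space at \<open>p\<close>, written in the coordinate bases of \<open>c\<close> and \<open>d\<close>.\<close>

definition tangent_map :: "('a, 'e) chart \<Rightarrow> ('a, 'e) chart \<Rightarrow> 'a \<Rightarrow> 'e \<Rightarrow> 'e" where
  "tangent_map c d p = frechet_derivative (transition c d) (at (coord c p))"

lemma transition_has_derivative:
  assumes "c \<in> \<A>" "d \<in> \<A>" "p \<in> chart_dom c" "p \<in> chart_dom d"
  shows "(transition c d has_derivative tangent_map c d p) (at (coord c p))"
  unfolding tangent_map_def
  using smooth_on_has_derivative[OF smooth_transition[OF assms(1,2)] coord_in_overlap[OF assms(1,3,4)]] .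

lemma linear_tangent_map:
  assumes "c \<in> \<A>" "d \<in> \<A>" "p \<in> chart_dom c" "p \<in> chart_dom d"
  shows "linear (tangent_map c d p)"
  using transition_has_derivative[OF assms] has_derivative_linear by blast

lemma tangent_map_cocycle:
  assumes "b \<in> \<A>" "c \<in> \<A>" "d \<in> \<A>" "p \<in> chart_dom b" "p \<in> chart_dom c" "p \<in> chart_dom d"
  shows "tangent_map c d p (tangent_map b c p v) = tangent_map b d p v"
proof -
  let ?S = "overlap b c \<inter> overlap b d"
  have "(transition c d \<circ> transition b c has_derivative tangent_map c d p \<circ> tangent_map b c p) (at (coord b p))"
    using assms by (intro diff_chain_at transition_has_derivative)
      (auto simp: transition_coord intro: transition_has_derivative)
  then have "(transition b d has_derivative tangent_map c d p \<circ> tangent_map b c p) (at (coord b p))"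
    by (rule has_derivative_transform_within_open[of _ _ _ _ ?S])
       (use assms in \<open>auto simp: open_overlap coord_in_overlap open_Int overlap_iff transition_def\<close>)
  from has_derivative_unique[OF this transition_has_derivative] assms
  show ?thesis by (metis comp_apply)
qed

lemma tangent_map_self:
  assumes "c \<in> \<A>" "p \<in> chart_dom c"
  shows "tangent_map c c p v = v"
proof -
  have "(transition c c has_derivative (\<lambda>v. v)) (at (coord c p))"
    by (rule has_derivative_transform_within_open[OF has_derivative_ident open_chart_image[OF assms(1)]])
       (use assms in \<open>auto simp: transition_def\<close>)
  from has_derivative_unique[OF this transition_has_derivative] assms show ?thesis by metis
qed

lemma field_rep_coord:
  assumes "c \<in> \<A>" "p \<in> chart_dom c"
  shows "field_rep \<A> c X (coord c p) = tangent_map (chart_for p) c p (X p)"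
  using assms by (simp add: field_rep_def Let_def tangent_map_def)

lemma field_rep_chart_at: "field_rep \<A> (chart_for p) X (coord (chart_for p) p) = X p"
  by (simp add: field_rep_coord chart_at_in_atlas chart_at_dom tangent_map_self)

lemma linear_tangent_map_chart_at: "c \<in> \<A> \<Longrightarrow> p \<in> chart_dom c \<Longrightarrow> linear (tangent_map (chart_for p) c p)"
  by (simp add: linear_tangent_map chart_at_in_atlas chart_at_dom)

lemma field_rep_add:
  assumes "c \<in> \<A>" "u \<in> chart_image c"
  shows "field_rep \<A> c (\<lambda>p. X p + Y p) u = field_rep \<A> c X u + field_rep \<A> c Y u"
  using field_rep_coord[OF assms(1) param_in_dom[OF assms]] linear_tangent_map_chart_at[OF assms(1) param_in_dom[OF assms]] assms
  by (simp add: linear_add)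

lemma field_rep_scaleR:
  assumes "c \<in> \<A>" "u \<in> chart_image c"
  shows "field_rep \<A> c (\<lambda>p. f p *\<^sub>R X p) u = f (param c u) *\<^sub>R field_rep \<A> c X u"
  using field_rep_coord[OF assms(1) param_in_dom[OF assms]] linear_tangent_map_chart_at[OF assms(1) param_in_dom[OF assms]] assms
  by (simp add: linear_cmul)

lemma smooth_function_const: "smooth_function \<A> (\<lambda>p. k)"
  by (simp add: smooth_function_def comp_def smooth_on_const)

lemma smooth_function_add:
  "smooth_function \<A> f \<Longrightarrow> smooth_function \<A> g \<Longrightarrow> smooth_function \<A> (\<lambda>p. f p + g p)"
  by (simp add: smooth_function_def comp_def smooth_on_add open_chart_image)

lemma smooth_function_mult:
  "smooth_function \<A> f \<Longrightarrow> smooth_function \<A> g \<Longrightarrow> smooth_function \<A> (\<lambda>p. f p * g p)"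
  by (simp add: smooth_function_def comp_def smooth_on_mult open_chart_image)

lemma smooth_function_sum:
  "(\<And>i. i \<in> I \<Longrightarrow> smooth_function \<A> (f i)) \<Longrightarrow> smooth_function \<A> (\<lambda>p. \<Sum>i\<in>I. f i p)"
  by (simp add: smooth_function_def comp_def smooth_on_sum open_chart_image)

text \<open>Smoothness can be tested after multiplication with a function that may vanish elsewhere, since
  division by it is possible near the point in question.\<close>

lemma smooth_function_divide_locally:
  assumes "\<And>p. \<exists>\<psi>. smooth_function \<A> \<psi> \<and> \<psi> p \<noteq> 0 \<and> smooth_function \<A> (\<lambda>q. \<psi> q * f q)"
  shows "smooth_function \<A> f"
  unfolding smooth_function_def
proof (intro ballI smooth_on_local)
  fix c u assume c: "c \<in> \<A>" and u: "u \<in> chart_image c"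
  obtain \<psi> where \<psi>: "smooth_function \<A> \<psi>" "\<psi> (param c u) \<noteq> 0" "smooth_function \<A> (\<lambda>q. \<psi> q * f q)"
    using assms by blast
  let ?\<psi> = "\<psi> \<circ> param c"
  let ?T = "{v \<in> chart_image c. ?\<psi> v \<noteq> 0}"
  have sm: "smooth_on ?\<psi> (chart_image c)" "smooth_on ((\<lambda>q. \<psi> q * f q) \<circ> param c) (chart_image c)"
    using \<psi>(1,3) c by (auto simp: smooth_function_def)
  have "open (chart_image c \<inter> ?\<psi> -` (- {0}))"
    by (intro continuous_open_preimage smooth_on_imp_continuous_on sm open_chart_image c) auto
  then have T: "open ?T" by (simp add: vimage_def Int_def)
  have "smooth_on (\<lambda>v. inverse (?\<psi> v) * ((\<lambda>q. \<psi> q * f q) \<circ> param c) v) ?T"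
    by (intro smooth_on_mult smooth_on_inverse T smooth_on_subset[OF sm(1)] smooth_on_subset[OF sm(2)]) auto
  then have "smooth_on (f \<circ> param c) ?T"
    by (rule smooth_on_cong[OF T, rotated]) auto
  with T u \<psi>(2) show "\<exists>T. open T \<and> u \<in> T \<and> smooth_on (f \<circ> param c) T"
    by (intro exI[of _ ?T]) auto
qed

lemma vector_field_add:
  assumes "vector_field \<A> X" "vector_field \<A> Y"
  shows "vector_field \<A> (\<lambda>p. X p + Y p)"
  unfolding vector_field_def
proof
  fix c assume c: "c \<in> \<A>"
  have "smooth_on (\<lambda>u. field_rep \<A> c X u + field_rep \<A> c Y u) (chart_image c)"
    using assms c by (simp add: vector_field_def smooth_on_add open_chart_image)
  then show "smooth_on (field_rep \<A> c (\<lambda>p. X p + Y p)) (chart_image c)"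
    by (rule smooth_on_cong[OF open_chart_image[OF c], rotated]) (simp add: field_rep_add c)
qed

lemma vector_field_scaleR:
  assumes "smooth_function \<A> f" "vector_field \<A> X"
  shows "vector_field \<A> (\<lambda>p. f p *\<^sub>R X p)"
  unfolding vector_field_def
proof
  fix c assume c: "c \<in> \<A>"
  have "smooth_on (\<lambda>u. (f \<circ> param c) u *\<^sub>R field_rep \<A> c X u) (chart_image c)"
    using assms c unfolding vector_field_def smooth_function_def
    by (intro smooth_on_scaleR open_chart_image) blast+
  then show "smooth_on (field_rep \<A> c (\<lambda>p. f p *\<^sub>R X p)) (chart_image c)"
    by (rule smooth_on_cong[OF open_chart_image[OF c], rotated]) (simp add: field_rep_scaleR c)
qed

lemma vector_field_zero: "vector_field \<A> (\<lambda>p. 0)"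
  unfolding vector_field_def
proof
  fix c assume c: "c \<in> \<A>"
  have "field_rep \<A> c (\<lambda>p. 0) u = 0" if "u \<in> chart_image c" for u
    using field_rep_scaleR[OF c that, of "\<lambda>p. 0" "\<lambda>p. 0"] by simp
  then show "smooth_on (field_rep \<A> c (\<lambda>p. 0)) (chart_image c)"
    by (intro smooth_on_cong[OF open_chart_image[OF c] _ smooth_on_const[of 0]]) auto
qed

lemma vector_field_sum:
  assumes "\<And>i. i \<in> I \<Longrightarrow> vector_field \<A> (X i)"
  shows "vector_field \<A> (\<lambda>p. \<Sum>i\<in>I. X i p)"
  using assms
  by (induction I rule: infinite_finite_induct) (auto simp: vector_field_zero intro!: vector_field_add)

lemma vector_field_uminus: "vector_field \<A> X \<Longrightarrow> vector_field \<A> (\<lambda>p. - X p)"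
  using vector_field_scaleR[OF smooth_function_const[of "-1"]] by simp

lemma vector_field_diff:
  "vector_field \<A> X \<Longrightarrow> vector_field \<A> Y \<Longrightarrow> vector_field \<A> (\<lambda>p. X p - Y p)"
  using vector_field_add[OF _ vector_field_uminus] by simp

subsection \<open>Vector fields as derivations\<close>

lemma smooth_function_has_derivative:
  assumes "smooth_function \<A> f" "c \<in> \<A>" "p \<in> chart_dom c"
  shows "(f \<circ> param c has_derivative frechet_derivative (f \<circ> param c) (at (coord c p))) (at (coord c p))"
  using assms smooth_on_has_derivative[of "f \<circ> param c" "chart_image c"] by (simp add: smooth_function_def)

text \<open>The reference chart may jump from point to point; the chain rule replaces it by a chart that is
  kept fixed in a neighbourhood, as is needed to differentiate once more.\<close>

lemma dir_deriv_in_chart: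
  assumes f: "smooth_function \<A> f" and c: "c \<in> \<A>" "p \<in> chart_dom c"
  shows "dir_deriv \<A> X f p
       = frechet_derivative (f \<circ> param c) (at (coord c p)) (field_rep \<A> c X (coord c p))"
proof -
  define r where "r = chart_for p"
  have r: "r \<in> \<A>" "p \<in> chart_dom r" by (simp_all add: r_def chart_at_in_atlas chart_at_dom)
  have "((f \<circ> param c) \<circ> transition r c has_derivative
      frechet_derivative (f \<circ> param c) (at (coord c p)) \<circ> tangent_map r c p) (at (coord r p))"
    using f c r
    by (intro diff_chain_at transition_has_derivative)
       (auto simp: transition_coord intro: smooth_function_has_derivative)
  then have "(f \<circ> param r has_derivative
      frechet_derivative (f \<circ> param c) (at (coord c p)) \<circ> tangent_map r c p) (at (coord r p))"
    by (rule has_derivative_transform_within_open[OF _ open_overlap[OF r(1) c(1)]])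
       (use c r in \<open>auto simp: coord_in_overlap param_transition\<close>)
  from has_derivative_unique[OF this smooth_function_has_derivative[OF f r]]
  show ?thesis
    using c by (simp add: dir_deriv_def Let_def field_rep_coord r_def[symmetric]) (metis comp_apply)
qed

lemma smooth_function_dir_deriv:
  assumes "vector_field \<A> X" "smooth_function \<A> f"
  shows "smooth_function \<A> (dir_deriv \<A> X f)"
  unfolding smooth_function_def
proof
  fix c assume c: "c \<in> \<A>"
  have "smooth_on (\<lambda>u. frechet_derivative (f \<circ> param c) (at u) (field_rep \<A> c X u)) (chart_image c)"
    using assms c
    by (intro smooth_on_frechet_derivative) (auto simp: open_chart_image smooth_function_def vector_field_def)
  then show "smooth_on (dir_deriv \<A> X f \<circ> param c) (chart_image c)"
    by (rule smooth_on_cong[OF open_chart_image[OF c], rotated])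
       (simp add: dir_deriv_in_chart[OF assms(2) c] c)
qed

lemma dir_deriv_add_field:
  assumes "smooth_function \<A> f"
  shows "dir_deriv \<A> (\<lambda>p. X p + Y p) f p = dir_deriv \<A> X f p + dir_deriv \<A> Y f p"
  using has_derivative_linear[OF smooth_function_has_derivative[OF assms chart_at_in_atlas chart_at_dom]]
  by (simp add: dir_deriv_def Let_def linear_add)

lemma dir_deriv_scaleR_field:
  assumes "smooth_function \<A> f"
  shows "dir_deriv \<A> (\<lambda>p. h p *\<^sub>R X p) f p = h p * dir_deriv \<A> X f p"
  using has_derivative_linear[OF smooth_function_has_derivative[OF assms chart_at_in_atlas chart_at_dom]]
  by (simp add: dir_deriv_def Let_def linear_cmul)

lemma dir_deriv_const: "dir_deriv \<A> X (\<lambda>p. k) p = 0"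
  by (simp add: dir_deriv_def Let_def comp_def)

lemma dir_deriv_add:
  assumes "smooth_function \<A> f" "smooth_function \<A> g"
  shows "dir_deriv \<A> X (\<lambda>p. f p + g p) p = dir_deriv \<A> X f p + dir_deriv \<A> X g p"
  using has_derivative_add[OF assms[THEN smooth_function_has_derivative, OF chart_at_in_atlas chart_at_dom], of p]
  by (simp add: dir_deriv_def Let_def comp_def flip: frechet_derivative_at)

lemma dir_deriv_mult:
  assumes "smooth_function \<A> f" "smooth_function \<A> g"
  shows "dir_deriv \<A> X (\<lambda>p. f p * g p) p = f p * dir_deriv \<A> X g p + dir_deriv \<A> X f p * g p"
  using has_derivative_mult[OF assms[THEN smooth_function_has_derivative, OF chart_at_in_atlas chart_at_dom], of p]
  by (simp add: dir_deriv_def Let_def comp_def chart_at_in_atlas chart_at_dom flip: frechet_derivative_at)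

text \<open>In a chart both iterated derivatives have the same second-order part, by symmetry of the second
  derivative; what remains are the derivatives of the coefficients, which form the bracket.\<close>

lemma dir_deriv_lie_bracket:
  assumes X: "vector_field \<A> X" and Y: "vector_field \<A> Y" and f: "smooth_function \<A> f"
  shows "dir_deriv \<A> (lie_bracket \<A> X Y) f p
       = dir_deriv \<A> X (dir_deriv \<A> Y f) p - dir_deriv \<A> Y (dir_deriv \<A> X f) p"
proof -
  define r where "r = chart_for p"
  define u where "u = coord r p"
  define F where "F = f \<circ> param r"
  have r: "r \<in> \<A>" "p \<in> chart_dom r" by (simp_all add: r_def chart_at_in_atlas chart_at_dom)
  have u: "u \<in> chart_image r" by (simp add: u_def r)
  have F: "smooth_on F (chart_image r)" using f r by (simp add: F_def smooth_function_def)
  have linF: "linear (frechet_derivative F (at u))"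
    by (rule linear_frechet_derivative[OF smooth_on_imp_differentiable[OF F u]])
  \<comment> \<open>In coordinates \<open>W f\<close> is \<open>\<Sum>b. W\<^sup>b \<partial>\<^sub>b F\<close>; its derivative along \<open>Z\<close> consists of the second derivative of \<open>F\<close>
    in the frozen direction \<open>W p\<close> and the first derivative of \<open>F\<close> along \<open>DW(Z)\<close>.\<close>
  have second: "dir_deriv \<A> Z (dir_deriv \<A> W f) p
      = frechet_derivative (\<lambda>v. frechet_derivative F (at v) (W p)) (at u) (Z p)
        + frechet_derivative F (at u) (frechet_derivative (field_rep \<A> r W) (at u) (Z p))"
    if W: "vector_field \<A> W" for Z W
  proof -
    let ?W = "field_rep \<A> r W" let ?D = "\<lambda>b v. frechet_derivative F (at v) b"
    have smW: "smooth_on ?W (chart_image r)" using W r by (simp add: vector_field_def)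
    have smb: "smooth_on (?D b) (chart_image r)" for b by (rule smooth_on_directional[OF F])
    note derW = smooth_on_has_derivative[OF smW u] and derb = smooth_on_has_derivative[OF smb u]
    have "((\<lambda>v. \<Sum>b\<in>Basis. (?W v \<bullet> b) * ?D b v) has_derivative
        (\<lambda>z. \<Sum>b\<in>Basis. (?W u \<bullet> b) * frechet_derivative (?D b) (at u) z
              + (frechet_derivative ?W (at u) z \<bullet> b) * ?D b u)) (at u)"
      by (intro has_derivative_sum has_derivative_mult derb bounded_linear.has_derivative[OF bounded_linear_inner_left] derW)
    then have *: "(dir_deriv \<A> W f \<circ> param r has_derivative
        (\<lambda>z. \<Sum>b\<in>Basis. (?W u \<bullet> b) * frechet_derivative (?D b) (at u) z
              + (frechet_derivative ?W (at u) z \<bullet> b) * ?D b u)) (at u)"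
    proof (rule has_derivative_transform_within_open[OF _ open_chart_image[OF r(1)] u])
      fix v assume v: "v \<in> chart_image r"
      show "(\<Sum>b\<in>Basis. (?W v \<bullet> b) * ?D b v) = (dir_deriv \<A> W f \<circ> param r) v"
        using linear_euclidean_expansion[OF linear_frechet_derivative[OF smooth_on_imp_differentiable[OF F v]], of "?W v"]
          v dir_deriv_in_chart[OF f r(1) param_in_dom[OF r(1) v], of W] r
        by (simp add: F_def)
    qed
    have W_u: "?W u = W p" using field_rep_chart_at by (simp add: u_def r_def)
    have lin2: "linear (\<lambda>w. frechet_derivative (?D w) (at u) z)" for z
    proof (rule linearI)
      fix w w' and k :: real
      have "((\<lambda>v. ?D w v + ?D w' v) has_derivative
          (\<lambda>z. frechet_derivative (?D w) (at u) z + frechet_derivative (?D w') (at u) z)) (at u)"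
        by (intro has_derivative_add derb)
      then have "(?D (w + w') has_derivative
          (\<lambda>z. frechet_derivative (?D w) (at u) z + frechet_derivative (?D w') (at u) z)) (at u)"
        by (rule has_derivative_transform_within_open[OF _ open_chart_image[OF r(1)] u])
           (simp add: linear_add linear_frechet_derivative smooth_on_imp_differentiable[OF F])
      then show "frechet_derivative (?D (w + w')) (at u) z
          = frechet_derivative (?D w) (at u) z + frechet_derivative (?D w') (at u) z"
        by (simp flip: frechet_derivative_at)
      have "((\<lambda>v. k *\<^sub>R ?D w v) has_derivative (\<lambda>z. k *\<^sub>R frechet_derivative (?D w) (at u) z)) (at u)"
        by (intro has_derivative_scaleR_right derb)
      then have "(?D (k *\<^sub>R w) has_derivative (\<lambda>z. k *\<^sub>R frechet_derivative (?D w) (at u) z)) (at u)"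
        by (rule has_derivative_transform_within_open[OF _ open_chart_image[OF r(1)] u])
           (simp add: linear_cmul linear_frechet_derivative smooth_on_imp_differentiable[OF F])
      then show "frechet_derivative (?D (k *\<^sub>R w)) (at u) z = k *\<^sub>R frechet_derivative (?D w) (at u) z"
        by (simp flip: frechet_derivative_at)
    qed
    have "dir_deriv \<A> Z (dir_deriv \<A> W f) p
        = frechet_derivative (dir_deriv \<A> W f \<circ> param r) (at u) (Z p)"
      by (simp add: dir_deriv_def[of \<A> Z] Let_def r_def u_def)
    also have "\<dots> = (\<Sum>b\<in>Basis. (W p \<bullet> b) * frechet_derivative (?D b) (at u) (Z p))
        + (\<Sum>b\<in>Basis. (frechet_derivative ?W (at u) (Z p) \<bullet> b) * ?D b u)"
      by (simp add: sum.distrib W_u flip: frechet_derivative_at[OF *])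
    finally show ?thesis
      using linear_euclidean_expansion[OF lin2[of "Z p"], of "W p"]
        linear_euclidean_expansion[OF linF, of "frechet_derivative ?W (at u) (Z p)"] by simp
  qed
  have "dir_deriv \<A> (lie_bracket \<A> X Y) f p
      = frechet_derivative F (at u) (frechet_derivative (field_rep \<A> r Y) (at u) (X p)
          - frechet_derivative (field_rep \<A> r X) (at u) (Y p))"
    by (simp add: dir_deriv_def lie_bracket_def Let_def F_def r_def u_def)
  then show ?thesis
    using second[OF X, of Y] second[OF Y, of X] linear_diff[OF linF]
      symmetric_second_derivative[OF open_chart_image[OF r(1)] u F, of "X p" "Y p"]
    by simp
qed

subsection \<open>Localised frames\<close>

text \<open>The image of the closed ball in the manifold is compact, hence closed because the manifold is
  Hausdorff, so a point outside of \<open>chart_dom c\<close> has a neighbourhood that avoids it.  This is what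
  makes the extensions by zero below smooth at the boundary of the chart.\<close>

lemma vanish_near:
  assumes c: "c \<in> \<A>" and d: "d \<in> \<A>" and ball: "cball x r \<subseteq> chart_image c"
    and v: "v \<in> chart_image d" "param d v \<notin> chart_dom c"
  obtains T where "open T" "v \<in> T" "T \<subseteq> chart_image d"
    "\<And>w. w \<in> T \<Longrightarrow> param d w \<in> chart_dom c \<Longrightarrow> coord c (param d w) \<notin> ball x r"
proof -
  let ?K = "param c ` cball x r"
  have "continuous_on (cball x r) (param c)"
    using chart_homeomorphism[OF c] homeomorphism_cont2 ball continuous_on_subset by blast
  then have "closed ?K" by (intro compact_imp_closed compact_continuous_image) auto
  then have "open {w \<in> chart_image d. param d w \<in> - ?K}" by (intro open_param_vimage d) auto
  moreover have "param d v \<notin> ?K" using v(2) ball c by (metis imageE param_in_dom subsetD)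
  moreover have "coord c (param d w) \<notin> ball x r"
    if "w \<in> {w \<in> chart_image d. param d w \<in> - ?K}" "param d w \<in> chart_dom c" for w
    using that c by (auto simp: image_iff simp del: mem_ball) (metis ball_subset_cball param_coord subsetD)
  ultimately show thesis using that[of "{w \<in> chart_image d. param d w \<in> - ?K}"] v by blast
qed

lemma smooth_function_extend:
  assumes c: "c \<in> \<A>" and ball: "cball x r \<subseteq> chart_image c"
    and g: "smooth_on g (chart_image c)" "\<And>u. u \<notin> ball x r \<Longrightarrow> g u = 0"
  shows "smooth_function \<A> (\<lambda>q. if q \<in> chart_dom c then g (coord c q) else 0)"
    (is "smooth_function \<A> ?F")
  unfolding smooth_function_def
proof (intro ballI smooth_on_local)
  fix d v assume d: "d \<in> \<A>" and v: "v \<in> chart_image d"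
  show "\<exists>T. open T \<and> v \<in> T \<and> smooth_on (?F \<circ> param d) T"
  proof (cases "param d v \<in> chart_dom c")
    case True
    have "transition d c ` overlap d c \<subseteq> chart_image c"
      using transition_in_overlap[OF d c] by (auto simp: overlap_iff)
    then have "smooth_on (\<lambda>w. g (transition d c w)) (overlap d c)"
      by (rule smooth_on_compose[OF open_overlap[OF d c] smooth_transition[OF d c] g(1)])
    then have "smooth_on (?F \<circ> param d) (overlap d c)"
      by (rule smooth_on_cong[OF open_overlap[OF d c], rotated]) (auto simp: overlap_iff transition_def)
    then show ?thesis using True v open_overlap[OF d c] by (auto simp: overlap_iff)
  next
    case False
    obtain T where T: "open T" "v \<in> T" "T \<subseteq> chart_image d"
      "\<And>w. w \<in> T \<Longrightarrow> param d w \<in> chart_dom c \<Longrightarrow> coord c (param d w) \<notin> ball x r"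
      using vanish_near[OF c d ball v False] by metis
    have "smooth_on (?F \<circ> param d) T"
      by (rule smooth_on_cong[OF T(1) _ smooth_on_const[of 0]]) (use T(4) g(2) in \<open>auto simp del: mem_ball\<close>)
    with T show ?thesis by blast
  qed
qed

lemma coordinate_field_extend:
  assumes c: "c \<in> \<A>" and ball: "cball x r \<subseteq> chart_image c"
    and g: "smooth_on g (chart_image c)" "\<And>u. u \<notin> ball x r \<Longrightarrow> g u = 0"
  shows "vector_field \<A> (\<lambda>q. if q \<in> chart_dom c then g (coord c q) *\<^sub>R tangent_map c (chart_for q) q b else 0)"
    (is "vector_field \<A> ?E")
  unfolding vector_field_def
proof (intro ballI smooth_on_local)
  fix d v assume d: "d \<in> \<A>" and v: "v \<in> chart_image d"
  have rep: "field_rep \<A> d ?E w = tangent_map (chart_for (param d w)) d (param d w) (?E (param d w))"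
    if "w \<in> chart_image d" for w
    using field_rep_coord[OF d param_in_dom[OF d that], of ?E] d that by (simp only: coord_param)
  show "\<exists>T. open T \<and> v \<in> T \<and> smooth_on (field_rep \<A> d ?E) T"
  proof (cases "param d v \<in> chart_dom c")
    case True
    have sub: "transition d c ` overlap d c \<subseteq> overlap c d" "transition d c ` overlap d c \<subseteq> chart_image c"
      using transition_in_overlap[OF d c] by (auto simp: overlap_iff)
    have "smooth_on (\<lambda>w. g (transition d c w) *\<^sub>R frechet_derivative (transition c d) (at (transition d c w)) b) (overlap d c)"
      using smooth_on_compose[OF open_overlap[OF d c] smooth_transition[OF d c] g(1) sub(2)]
        smooth_on_compose[OF open_overlap[OF d c] smooth_transition[OF d c]
          smooth_on_directional[OF smooth_transition[OF c d]] sub(1), of b]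
      by (intro smooth_on_scaleR open_overlap[OF d c])
    then have "smooth_on (field_rep \<A> d ?E) (overlap d c)"
    proof (rule smooth_on_cong[OF open_overlap[OF d c], rotated])
      fix w assume w: "w \<in> overlap d c"
      let ?q = "param d w"
      have q: "?q \<in> chart_dom d" "?q \<in> chart_dom c" and im: "w \<in> chart_image d"
        using w d by (auto simp: overlap_iff)
      have "field_rep \<A> d ?E w
          = g (coord c ?q) *\<^sub>R tangent_map (chart_for ?q) d ?q (tangent_map c (chart_for ?q) ?q b)"
        using q rep[OF im] linear_tangent_map_chart_at[OF d q(1)] by (simp add: linear_cmul)
      also have "\<dots> = g (coord c ?q) *\<^sub>R tangent_map c d ?q b"
        using q c d by (simp add: tangent_map_cocycle chart_at_in_atlas chart_at_dom)
      finally show "g (transition d c w) *\<^sub>R frechet_derivative (transition c d) (at (transition d c w)) b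
          = field_rep \<A> d ?E w"
        by (simp add: tangent_map_def transition_def)
    qed
    then show ?thesis using True v open_overlap[OF d c] by (auto simp: overlap_iff)
  next
    case False
    obtain T where T: "open T" "v \<in> T" "T \<subseteq> chart_image d"
      "\<And>w. w \<in> T \<Longrightarrow> param d w \<in> chart_dom c \<Longrightarrow> coord c (param d w) \<notin> ball x r"
      using vanish_near[OF c d ball v False] by metis
    have zero: "field_rep \<A> d ?E w = 0" if "w \<in> T" for w
    proof -
      have im: "w \<in> chart_image d" using T(3) that by blast
      have "?E (param d w) = 0" using T(4)[OF that] g(2) by auto
      then show ?thesis
        using rep[OF im] linear_tangent_map_chart_at[OF d param_in_dom[OF d im]] by (simp only: linear_0)
    qed
    have "smooth_on (field_rep \<A> d ?E) T"
      by (rule smooth_on_cong[OF T(1) zero[symmetric] smooth_on_const[of 0]])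
    with T show ?thesis by blast
  qed
qed

text \<open>A substitute for a coordinate frame by global objects: the fields \<open>E b\<close> equal the coordinate
  fields at \<open>p\<close>, and every field, once multiplied with the cut-off function \<open>\<phi>\<close>, is a combination of
  them with smooth coefficients that depend linearly on it over the functions.\<close>

definition frame_at ::
  "'a \<Rightarrow> ('a \<Rightarrow> real) \<Rightarrow> ('e \<Rightarrow> 'a \<Rightarrow> 'e) \<Rightarrow> ('e \<Rightarrow> ('a \<Rightarrow> 'e) \<Rightarrow> 'a \<Rightarrow> real) \<Rightarrow> bool" where
  "frame_at p \<phi> E coef \<longleftrightarrow>
     smooth_function \<A> \<phi> \<and> \<phi> p = 1 \<and>
     (\<forall>b. vector_field \<A> (E b) \<and> E b p = b) \<and>
     (\<forall>b V. vector_field \<A> V \<longrightarrow> smooth_function \<A> (coef b V)) \<and>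
     (\<forall>V q. \<phi> q *\<^sub>R V q = (\<Sum>b\<in>Basis. coef b V q *\<^sub>R E b q)) \<and>
     (\<forall>b\<in>Basis. coef b (E b) = \<phi>) \<and>
     (\<forall>b f V q. coef b (\<lambda>q. f q *\<^sub>R V q) q = f q * coef b V q) \<and>
     (\<forall>b V. coef b V p = V p \<bullet> b)"

text \<open>One bump function \<open>\<psi>\<close> localises the coordinate fields and a second copy localises the components
  of a field; therefore the cut-off function is \<open>\<psi>\<^sup>2\<close>.\<close>

lemma frame_exists:
  obtains \<phi> E coef where "frame_at p \<phi> E coef"
proof -
  define c where "c = chart_for p"
  have c: "c \<in> \<A>" "p \<in> chart_dom c" by (simp_all add: c_def chart_at_in_atlas chart_at_dom)
  obtain r where r: "r > 0" "cball (coord c p) r \<subseteq> chart_image c"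
    using open_chart_image[OF c(1)] coord_in_image[OF c(2)] open_contains_cball by metis
  obtain \<psi> :: "'e \<Rightarrow> real" where \<psi>: "smooth_on \<psi> UNIV" "\<psi> (coord c p) = 1"
    "\<And>u. u \<notin> ball (coord c p) r \<Longrightarrow> \<psi> u = 0"
    using bump_function_exists[OF r(1)] by metis
  have sm\<psi>: "smooth_on \<psi> (chart_image c)" by (rule smooth_on_subset[OF \<psi>(1)]) simp
  define \<phi> where "\<phi> q = (if q \<in> chart_dom c then \<psi> (coord c q) * \<psi> (coord c q) else 0)" for q
  define E where "E b q = (if q \<in> chart_dom c then \<psi> (coord c q) *\<^sub>R tangent_map c (chart_for q) q b else 0)" for b q
  define coef where "coef b V q = (if q \<in> chart_dom c then \<psi> (coord c q) * (field_rep \<A> c V (coord c q) \<bullet> b) else 0)"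
    for b V q
  have rep: "field_rep \<A> c V (coord c q) = tangent_map (chart_for q) c q (V q)" if "q \<in> chart_dom c" for V q
    using field_rep_coord[OF c(1) that] .
  have inv: "tangent_map c (chart_for q) q (tangent_map (chart_for q) c q v) = v"
    "tangent_map (chart_for q) c q (tangent_map c (chart_for q) q v) = v" if "q \<in> chart_dom c" for q v
    using that c(1) by (simp_all add: tangent_map_cocycle tangent_map_self chart_at_in_atlas chart_at_dom)
  have lin: "linear (tangent_map c (chart_for q) q)" "linear (tangent_map (chart_for q) c q)"
    if "q \<in> chart_dom c" for q
    using that c(1) by (simp_all add: linear_tangent_map chart_at_in_atlas chart_at_dom)
  show thesis
  proof (rule that[of \<phi> E coef], unfold frame_at_def, intro conjI allI ballI impI)
    show "smooth_function \<A> \<phi>" unfolding \<phi>_def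
      by (rule smooth_function_extend[OF c(1) r(2), where g = "\<lambda>u. \<psi> u * \<psi> u"])
         (use \<psi>(3) in \<open>auto intro!: smooth_on_mult sm\<psi> open_chart_image c(1)\<close>)
    show "\<phi> p = 1" by (simp add: \<phi>_def \<psi>(2) c)
    show "vector_field \<A> (E b)" for b unfolding E_def
      by (rule coordinate_field_extend[OF c(1) r(2) sm\<psi> \<psi>(3)])
    show "E b p = b" for b by (simp add: E_def \<psi>(2) c tangent_map_self flip: c_def)
    show "smooth_function \<A> (coef b V)" if "vector_field \<A> V" for b V unfolding coef_def
      by (rule smooth_function_extend[OF c(1) r(2), where g = "\<lambda>u. \<psi> u * (field_rep \<A> c V u \<bullet> b)"])
         (use \<psi>(3) that c(1) in \<open>auto simp: vector_field_def intro!: smooth_on_mult smooth_on_inner smooth_on_const sm\<psi> open_chart_image\<close>)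
    show "\<phi> q *\<^sub>R V q = (\<Sum>b\<in>Basis. coef b V q *\<^sub>R E b q)" for V q
    proof (cases "q \<in> chart_dom c")
      case True
      show ?thesis
        using True arg_cong[OF linear_euclidean_expansion[OF lin(1)[OF True],
              of "tangent_map (chart_for q) c q (V q)"], of "\<lambda>x. (\<psi> (coord c q) * \<psi> (coord c q)) *\<^sub>R x"]
        by (simp add: \<phi>_def E_def coef_def rep inv scaleR_sum_right mult.assoc mult.commute mult.left_commute)
    qed (simp add: \<phi>_def coef_def)
    show "coef b (E b) = \<phi>" if "b \<in> Basis" for b
      using that by (auto simp: fun_eq_iff coef_def E_def \<phi>_def rep inv linear_cmul[OF lin(2)] inner_Basis)
    show "coef b (\<lambda>q. f q *\<^sub>R V q) q = f q * coef b V q" for b f V q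
      by (simp add: coef_def rep linear_cmul[OF lin(2)])
    show "coef b V p = V p \<bullet> b" for b V
      using field_rep_chart_at[of p V] by (simp add: coef_def \<psi>(2) c flip: c_def)
  qed
qed

lemma field_extension_properties:
  "vector_field \<A> (field_extension \<A> p x)" "field_extension \<A> p x p = x"
proof -
  have "\<exists>X. vector_field \<A> X \<and> X p = x" using frame_exists[of p] unfolding frame_at_def by metis
  from someI_ex[OF this]
  show "vector_field \<A> (field_extension \<A> p x)" "field_extension \<A> p x p = x"
    by (auto simp: field_extension_def)
qed

text \<open>Near \<open>p\<close> a field is a combination of frame fields with function coefficients, and a
  function-linear operator sees only the values of these coefficients at \<open>p\<close>.\<close>

lemma tensorial_at:
  fixes T :: "('a \<Rightarrow> 'e) \<Rightarrow> 'b::real_vector"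
  assumes add: "\<And>X Y. vector_field \<A> X \<Longrightarrow> vector_field \<A> Y \<Longrightarrow> T (\<lambda>q. X q + Y q) = T X + T Y"
    and mult: "\<And>f X. smooth_function \<A> f \<Longrightarrow> vector_field \<A> X \<Longrightarrow> T (\<lambda>q. f q *\<^sub>R X q) = f p *\<^sub>R T X"
    and XY: "vector_field \<A> X" "vector_field \<A> Y" "X p = Y p"
  shows "T X = T Y"
proof -
  obtain \<phi> E coef where frame: "frame_at p \<phi> E coef" by (rule frame_exists)
  then have expand: "\<phi> q *\<^sub>R V q = (\<Sum>b\<in>Basis. coef b V q *\<^sub>R E b q)" for V q
    by (simp add: frame_at_def)
  have fr: "smooth_function \<A> \<phi>" "\<phi> p = 1" "vector_field \<A> (E b)"
    "vector_field \<A> V \<Longrightarrow> smooth_function \<A> (coef b V)" "coef b V p = V p \<bullet> b" for b V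
    using frame by (simp_all add: frame_at_def)
  have zero: "T (\<lambda>q. 0) = 0" using add[OF vector_field_zero vector_field_zero] by simp
  have sum: "T (\<lambda>q. \<Sum>i\<in>I. Z i q) = (\<Sum>i\<in>I. T (Z i))"
    if "\<And>i. i \<in> I \<Longrightarrow> vector_field \<A> (Z i)" for I :: "'e set" and Z
    using that by (induction I rule: infinite_finite_induct) (auto simp: zero add vector_field_sum)
  have "T V = (\<Sum>b\<in>Basis. (V p \<bullet> b) *\<^sub>R T (E b))" if V: "vector_field \<A> V" for V
  proof -
    have "T V = T (\<lambda>q. \<phi> q *\<^sub>R V q)" using fr V by (simp add: mult)
    also have "\<dots> = T (\<lambda>q. \<Sum>b\<in>Basis. coef b V q *\<^sub>R E b q)" by (simp only: expand)
    also have "\<dots> = (\<Sum>b\<in>Basis. T (\<lambda>q. coef b V q *\<^sub>R E b q))"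
      using fr V by (intro sum vector_field_scaleR) auto
    also have "\<dots> = (\<Sum>b\<in>Basis. (V p \<bullet> b) *\<^sub>R T (E b))" using fr V by (simp add: mult)
    finally show ?thesis .
  qed
  with XY show ?thesis by simp
qed

end

section \<open>Curvature of a torsion free connection\<close>

locale torsion_free_connection = smooth_manifold \<A>
  for \<A> :: "('a::{t2_space,second_countable_topology}, 'e::euclidean_space) chart set" +
  fixes D :: "('a \<Rightarrow> 'e) \<Rightarrow> ('a \<Rightarrow> 'e) \<Rightarrow> 'a \<Rightarrow> 'e"
  assumes connection: "connection \<A> D" and torsion_free: "torsion_free \<A> D"
begin

abbreviation VF :: "('a \<Rightarrow> 'e) \<Rightarrow> bool" where "VF \<equiv> vector_field \<A>"
abbreviation SF :: "('a \<Rightarrow> real) \<Rightarrow> bool" where "SF \<equiv> smooth_function \<A>"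
abbreviation R :: "('a \<Rightarrow> 'e) \<Rightarrow> ('a \<Rightarrow> 'e) \<Rightarrow> ('a \<Rightarrow> 'e) \<Rightarrow> 'a \<Rightarrow> 'e" where "R \<equiv> curvature \<A> D"

lemma D_field [simp]: "VF X \<Longrightarrow> VF Y \<Longrightarrow> VF (D X Y)"
  and D_add_left: "VF X \<Longrightarrow> VF X' \<Longrightarrow> VF Y \<Longrightarrow> D (\<lambda>p. X p + X' p) Y = (\<lambda>p. D X Y p + D X' Y p)"
  and D_scaleR_left: "SF f \<Longrightarrow> VF X \<Longrightarrow> VF Y \<Longrightarrow> D (\<lambda>p. f p *\<^sub>R X p) Y = (\<lambda>p. f p *\<^sub>R D X Y p)"
  and D_add_right: "VF X \<Longrightarrow> VF Y \<Longrightarrow> VF Y' \<Longrightarrow> D X (\<lambda>p. Y p + Y' p) = (\<lambda>p. D X Y p + D X Y' p)"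
  and D_scaleR_right: "SF f \<Longrightarrow> VF X \<Longrightarrow> VF Y \<Longrightarrow>
    D X (\<lambda>p. f p *\<^sub>R Y p) = (\<lambda>p. f p *\<^sub>R D X Y p + dir_deriv \<A> X f p *\<^sub>R Y p)"
  using connection unfolding connection_def by blast+

declare vector_field_add [simp] vector_field_diff [simp] vector_field_scaleR [simp]
  smooth_function_dir_deriv [simp] smooth_function_mult [simp] smooth_function_add [simp]
  smooth_function_const [simp]

lemma D_diff_left: "VF X \<Longrightarrow> VF X' \<Longrightarrow> VF Y \<Longrightarrow> D (\<lambda>p. X p - X' p) Y = (\<lambda>p. D X Y p - D X' Y p)"
  using D_add_left[of X "\<lambda>p. (-1) *\<^sub>R X' p" Y] D_scaleR_left[of "\<lambda>p. -1" X' Y]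
  by (simp add: vector_field_uminus)

lemma D_diff_right: "VF X \<Longrightarrow> VF Y \<Longrightarrow> VF Y' \<Longrightarrow> D X (\<lambda>p. Y p - Y' p) = (\<lambda>p. D X Y p - D X Y' p)"
  using D_add_right[of X Y "\<lambda>p. (-1) *\<^sub>R Y' p"] D_scaleR_right[of "\<lambda>p. -1" X Y']
  by (simp add: vector_field_uminus dir_deriv_const)

lemma lie_bracket_eq: "VF X \<Longrightarrow> VF Y \<Longrightarrow> lie_bracket \<A> X Y = (\<lambda>p. D X Y p - D Y X p)"
  using torsion_free by (simp add: torsion_free_def fun_eq_iff)

lemma curvature_eq:
  assumes "VF X" "VF Y" "VF Z"
  shows "R X Y Z = (\<lambda>p. D X (D Y Z) p - D Y (D X Z) p - (D (D X Y) Z p - D (D Y X) Z p))"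
  using assms by (simp add: fun_eq_iff curvature_def lie_bracket_eq D_diff_left)

lemma curvature_field [simp]: "VF X \<Longrightarrow> VF Y \<Longrightarrow> VF Z \<Longrightarrow> VF (R X Y Z)"
  by (simp add: curvature_eq)

lemma curvature_swap: "VF X \<Longrightarrow> VF Y \<Longrightarrow> VF Z \<Longrightarrow> R X Y Z p = - R Y X Z p"
  by (simp add: curvature_eq)

lemma curvature_add_left:
  "VF X \<Longrightarrow> VF X' \<Longrightarrow> VF Y \<Longrightarrow> VF Z \<Longrightarrow> R (\<lambda>q. X q + X' q) Y Z p = R X Y Z p + R X' Y Z p"
  by (simp add: curvature_eq D_add_left D_add_right)

lemma curvature_add_right:
  "VF X \<Longrightarrow> VF Y \<Longrightarrow> VF Z \<Longrightarrow> VF Z' \<Longrightarrow> R X Y (\<lambda>q. Z q + Z' q) p = R X Y Z p + R X Y Z' p"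
  by (simp add: curvature_eq D_add_left D_add_right)

lemma curvature_scaleR_left:
  "SF f \<Longrightarrow> VF X \<Longrightarrow> VF Y \<Longrightarrow> VF Z \<Longrightarrow> R (\<lambda>q. f q *\<^sub>R X q) Y Z p = f p *\<^sub>R R X Y Z p"
  by (simp add: curvature_eq D_scaleR_left D_scaleR_right D_add_left algebra_simps)

text \<open>The second derivatives of \<open>f\<close> that the product rule produces cancel because the bracket acts on
  functions as a commutator.\<close>

lemma curvature_scaleR_right:
  assumes "SF f" "VF X" "VF Y" "VF Z"
  shows "R X Y (\<lambda>q. f q *\<^sub>R Z q) p = f p *\<^sub>R R X Y Z p"
proof -
  have "dir_deriv \<A> X (dir_deriv \<A> Y f) p - dir_deriv \<A> Y (dir_deriv \<A> X f) p
      = dir_deriv \<A> (lie_bracket \<A> X Y) f p"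
    using assms by (simp add: dir_deriv_lie_bracket)
  also have "\<dots> = dir_deriv \<A> (D X Y) f p - dir_deriv \<A> (D Y X) f p"
    using assms dir_deriv_add_field[of f "D X Y" "\<lambda>p. (-1) *\<^sub>R D Y X p" p]
      dir_deriv_scaleR_field[of f "\<lambda>p. -1" "D Y X" p]
    by (simp add: lie_bracket_eq)
  finally have "dir_deriv \<A> X (dir_deriv \<A> Y f) p *\<^sub>R Z p
      = (dir_deriv \<A> Y (dir_deriv \<A> X f) p + dir_deriv \<A> (D X Y) f p - dir_deriv \<A> (D Y X) f p) *\<^sub>R Z p"
    by simp
  then show ?thesis
    using assms by (simp add: curvature_eq D_scaleR_right D_add_right algebra_simps)
qed

text \<open>By tensoriality the arbitrary extensions in the definition of \<open>curvature_at\<close> may be replaced, one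
  slot at a time; the second slot is reduced to the first by antisymmetry.\<close>

lemma curvature_at_eq:
  assumes "VF X" "VF Y" "VF Z"
  shows "curvature_at \<A> D p (X p) (Y p) (Z p) = R X Y Z p"
proof -
  let ?e = "field_extension \<A> p"
  note e = field_extension_properties
  have "R (?e (X p)) (?e (Y p)) (?e (Z p)) p = R X (?e (Y p)) (?e (Z p)) p"
    using assms e
    by (intro tensorial_at[of "\<lambda>X. R X (?e (Y p)) (?e (Z p)) p" p])
       (auto simp: curvature_add_left curvature_scaleR_left)
  also have "\<dots> = - R (?e (Y p)) X (?e (Z p)) p" using assms e by (intro curvature_swap)
  also have "\<dots> = - R Y X (?e (Z p)) p"
    using assms e
    by (intro arg_cong[of _ _ uminus] tensorial_at[of "\<lambda>Y. R Y X (?e (Z p)) p" p])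
       (auto simp: curvature_add_left curvature_scaleR_left)
  also have "\<dots> = - R Y X Z p"
    using assms e
    by (intro arg_cong[of _ _ uminus] tensorial_at[of "\<lambda>Z. R Y X Z p" p])
       (auto simp: curvature_add_right curvature_scaleR_right)
  also have "\<dots> = R X Y Z p" using assms by (simp flip: curvature_swap)
  finally show ?thesis by (simp add: curvature_at_def)
qed

lemma linear_curvature_at: "linear (\<lambda>y. curvature_at \<A> D p x y z)" (is ?second)
  "linear (\<lambda>z. curvature_at \<A> D p x y z)" (is ?third)
proof -
  let ?e = "field_extension \<A> p"
  note e = field_extension_properties
  have at: "curvature_at \<A> D p (X p) (Y p) (Z p) = - R Y X Z p" if "VF X" "VF Y" "VF Z" for X Y Z
    using that by (simp add: curvature_at_eq flip: curvature_swap)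
  show ?second
  proof (rule linearI)
    show "curvature_at \<A> D p x (y + y') z = curvature_at \<A> D p x y z + curvature_at \<A> D p x y' z" for y y'
      using at[of "?e x" "\<lambda>q. ?e y q + ?e y' q" "?e z"] at[of "?e x" "?e y" "?e z"]
        at[of "?e x" "?e y'" "?e z"] e by (simp add: curvature_add_left)
    show "curvature_at \<A> D p x (k *\<^sub>R y) z = k *\<^sub>R curvature_at \<A> D p x y z" for k y
      using at[of "?e x" "\<lambda>q. k *\<^sub>R ?e y q" "?e z"] at[of "?e x" "?e y" "?e z"] e
      by (simp add: curvature_scaleR_left)
  qed
  show ?third
  proof (rule linearI)
    show "curvature_at \<A> D p x y (z + z') = curvature_at \<A> D p x y z + curvature_at \<A> D p x y z'" for z z'
      using at[of "?e x" "?e y" "\<lambda>q. ?e z q + ?e z' q"] at[of "?e x" "?e y" "?e z"]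
        at[of "?e x" "?e y" "?e z'"] e by (simp add: curvature_add_right)
    show "curvature_at \<A> D p x y (k *\<^sub>R z) = k *\<^sub>R curvature_at \<A> D p x y z" for k z
      using at[of "?e x" "?e y" "\<lambda>q. k *\<^sub>R ?e z q"] at[of "?e x" "?e y" "?e z"] e
      by (simp add: curvature_scaleR_right)
  qed
qed

text \<open>The covariant derivative \<open>(\<nabla>\<^sub>W R)(X,Y)Z\<close>.\<close>

definition curvature_deriv ::
  "('a \<Rightarrow> 'e) \<Rightarrow> ('a \<Rightarrow> 'e) \<Rightarrow> ('a \<Rightarrow> 'e) \<Rightarrow> ('a \<Rightarrow> 'e) \<Rightarrow> 'a \<Rightarrow> 'e" where
  "curvature_deriv W X Y Z p =
     D W (R X Y Z) p - R (D W X) Y Z p - R X (D W Y) Z p - R X Y (D W Z) p"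

text \<open>The cyclic sum of the commutators of \<open>\<nabla>\<^sub>W\<close> with \<open>[\<nabla>\<^sub>X, \<nabla>\<^sub>Y]\<close> vanishes by the Jacobi identity for
  operators.  The remaining terms add up to \<open>\<nabla>\<^sub>B Z\<close> up to sign, where \<open>B\<close> is the cyclic sum in the
  first Bianchi identity.  That identity is a hypothesis because it is equivalent to the Jacobi identity
  for the bracket, which would have to be computed in charts, while it is immediate for curvatures of
  the algebraic form considered below.\<close>

lemma second_bianchi:
  assumes VF: "VF W" "VF X" "VF Y" "VF Z"
    and first: "\<And>q. R X Y W q + R Y W X q + R W X Y q = 0"
  shows "curvature_deriv W X Y Z p + curvature_deriv X Y W Z p + curvature_deriv Y W X Z p = 0"
proof -
  have "D (\<lambda>q. R X Y W q + R Y W X q + R W X Y q) Z p = 0"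
    using VF D_scaleR_left[of "\<lambda>p. 0" W Z] by (simp add: first)
  then have "D (R X Y W) Z p + D (R Y W X) Z p + D (R W X Y) Z p = 0"
    using VF by (simp add: D_add_left)
  then show ?thesis
    using VF by (simp add: curvature_deriv_def curvature_eq D_diff_left D_diff_right)
      (simp add: algebra_simps)
qed

end

section \<open>Projectively flat, Ricci antisymmetric connections\<close>

locale projectively_flat_antisymmetric_connection = torsion_free_connection \<A> D
  for \<A> :: "('a::{t2_space,second_countable_topology}, 'e::euclidean_space) chart set" and D +
  assumes dim: "DIM('e) \<ge> 3"
    and projectively_flat: "projectively_flat_connection \<A> D"
    and ricci_antisymmetric: "ricci_antisymmetric_connection \<A> D"
begin

text \<open>The factor makes \<open>R = H(\<omega>)\<close> out of the vanishing of the projective curvature.\<close>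

definition \<omega> :: "'a \<Rightarrow> 'e \<Rightarrow> 'e \<Rightarrow> real" where
  "\<omega> p x y = - ricci_alt (curvature_at \<A> D p) x y / (1 + real DIM('e))"

lemma \<omega>_swap: "\<omega> p y x = - \<omega> p x y"
  by (simp add: \<omega>_def ricci_alt_def field_simps)

lemma curvature_at_\<omega>:
  "curvature_at \<A> D p x y z = (2 * \<omega> p x y) *\<^sub>R z + \<omega> p x z *\<^sub>R y - \<omega> p y z *\<^sub>R x"
proof -
  let ?A = "curvature_at \<A> D p" and ?k = "1 + real DIM('e)"
  have "?k \<noteq> 0" by linarith
  then have alt: "ricci_alt ?A x y / ?k = - \<omega> p x y" for x y
    by (simp add: \<omega>_def)
  have "ricci_sym ?A = (\<lambda>x y. 0)"
    using ricci_antisymmetric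
    by (simp add: ricci_antisymmetric_connection_def ricci_antisymmetric_def fun_eq_iff)
  moreover have "projective_curvature ?A x y z = 0"
    using projectively_flat by (simp add: projectively_flat_connection_def projectively_flat_def)
  ultimately have "?A x y z = - ((1 / ?k) *\<^sub>R H_op (ricci_alt ?A) x y z)"
    by (simp add: projective_curvature_def H_op_def eq_neg_iff_add_eq_0)
  also have "\<dots> = H_op (\<omega> p) x y z"
    by (simp add: H_op_def scaleR_right_distrib scaleR_diff_right alt)
  also have "\<dots> = (2 * \<omega> p x y) *\<^sub>R z + \<omega> p x z *\<^sub>R y - \<omega> p y z *\<^sub>R x"
    by (simp add: H_op_def \<omega>_swap[of p y x] scaleR_2 flip: scaleR_scaleR)
  finally show ?thesis .
qed

lemma linear_\<omega>_left: "linear (\<lambda>x. \<omega> p x y)"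
proof -
  let ?A = "curvature_at \<A> D p" and ?k = "1 + real DIM('e)"
  have inner: "linear (\<lambda>x. f x \<bullet> b)" if "linear f" for f :: "'e \<Rightarrow> 'e" and b
    using linear_compose[OF that bounded_linear.linear[OF bounded_linear_inner_left]] by (simp add: comp_def)
  have "linear (\<lambda>x. ricci ?A x y)" "linear (\<lambda>x. ricci ?A y x)"
    unfolding ricci_def linear_trace_def
    by (intro linear_compose_sum ballI inner linear_curvature_at)+
  then have "linear (\<lambda>x. (- 1 / (2 * ?k)) *\<^sub>R (ricci ?A x y - ricci ?A y x))"
    by (intro linear_compose_scale_right linear_compose_sub)
  moreover have "\<omega> p x y = (- 1 / (2 * ?k)) *\<^sub>R (ricci ?A x y - ricci ?A y x)" for x
    by (simp add: \<omega>_def ricci_alt_def)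
  ultimately show ?thesis by simp
qed

lemma linear_\<omega>_right: "linear (\<omega> p x)"
proof -
  have "\<omega> p x = (\<lambda>y. - \<omega> p y x)" by (rule ext) (rule \<omega>_swap)
  then show ?thesis using linear_compose_neg[OF linear_\<omega>_left[of p x]] by simp
qed

lemmas \<omega>_linear = linear_add[OF linear_\<omega>_left] linear_diff[OF linear_\<omega>_left] linear_cmul[OF linear_\<omega>_left]
  linear_add[OF linear_\<omega>_right] linear_diff[OF linear_\<omega>_right] linear_cmul[OF linear_\<omega>_right]

definition \<Omega> :: "('a \<Rightarrow> 'e) \<Rightarrow> ('a \<Rightarrow> 'e) \<Rightarrow> 'a \<Rightarrow> real" where
  "\<Omega> X Y p = \<omega> p (X p) (Y p)"

lemma \<Omega>_swap: "\<Omega> Y X p = - \<Omega> X Y p"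
  unfolding \<Omega>_def by (rule \<omega>_swap)

lemma curvature_\<Omega>:
  assumes "VF X" "VF Y" "VF Z"
  shows "R X Y Z = (\<lambda>p. (2 * \<Omega> X Y p) *\<^sub>R Z p + \<Omega> X Z p *\<^sub>R Y p - \<Omega> Y Z p *\<^sub>R X p)"
  using curvature_at_eq[OF assms] by (simp add: fun_eq_iff \<Omega>_def flip: curvature_at_\<omega>)

text \<open>The field \<open>R(X,Y)Y = 3 \<omega>(X,Y) Y\<close> is smooth, so \<open>\<omega>(X,Y)\<close> is smooth where \<open>Y\<close> does not vanish, for
  instance for the fields \<open>Y\<close> of a local frame.\<close>

lemma smooth_\<Omega> [simp]:
  assumes "VF X" "VF Y"
  shows "SF (\<Omega> X Y)"
proof (rule smooth_function_divide_locally)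
  fix p
  obtain \<phi> E coef where frame: "frame_at p \<phi> E coef" by (rule frame_exists)
  then have fr: "SF \<phi>" "\<phi> p = 1" "VF (E b)" "VF V \<Longrightarrow> SF (coef b V)"
    "b \<in> Basis \<Longrightarrow> coef b (E b) = \<phi>"
    "coef b (\<lambda>q. f q *\<^sub>R V q) q = f q * coef b V q" for b f V q
    by (simp_all add: frame_at_def)
  have expand: "\<phi> q *\<^sub>R V q = (\<Sum>b\<in>Basis. coef b V q *\<^sub>R E b q)" for V q
    using frame by (simp add: frame_at_def)
  have on_frame: "SF (\<lambda>q. \<phi> q * \<Omega> X (E b) q)" if b: "b \<in> Basis" for b
  proof -
    have R_eq: "R X (E b) (E b) = (\<lambda>q. (3 * \<Omega> X (E b) q) *\<^sub>R E b q)"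
    proof
      fix q
      have "\<Omega> (E b) (E b) q = 0" using \<Omega>_swap[of "E b" "E b" q] by simp
      then show "R X (E b) (E b) q = (3 * \<Omega> X (E b) q) *\<^sub>R E b q"
        using assms fr(3) by (simp add: curvature_\<Omega> flip: scaleR_add_left)
    qed
    have "coef b (R X (E b) (E b)) = (\<lambda>q. 3 * (\<phi> q * \<Omega> X (E b) q))"
      unfolding R_eq using fr(6)[of b "\<lambda>q. 3 * \<Omega> X (E b) q" "E b"] fr(5)[OF b]
      by (simp add: fun_eq_iff mult_ac)
    moreover have "SF (coef b (R X (E b) (E b)))" using fr assms by simp
    ultimately show ?thesis
      using smooth_function_mult[OF smooth_function_const[of "1/3"], of "\<lambda>q. 3 * (\<phi> q * \<Omega> X (E b) q)"]
      by simp
  qed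
  have "(\<phi> q * \<phi> q) * \<Omega> X Y q = (\<Sum>b\<in>Basis. coef b Y q * (\<phi> q * \<Omega> X (E b) q))" for q
  proof -
    have "\<phi> q * \<Omega> X Y q = \<omega> q (X q) (\<Sum>b\<in>Basis. coef b Y q *\<^sub>R E b q)"
      using expand[of q Y] \<omega>_linear(6)[of q "X q" "\<phi> q" "Y q"] by (simp add: \<Omega>_def)
    also have "\<dots> = (\<Sum>b\<in>Basis. coef b Y q * \<Omega> X (E b) q)"
      by (simp add: linear_sum[OF linear_\<omega>_right] \<omega>_linear \<Omega>_def)
    finally show ?thesis by (simp add: sum_distrib_left mult_ac)
  qed
  moreover have "SF (\<lambda>q. \<Sum>b\<in>Basis. coef b Y q * (\<phi> q * \<Omega> X (E b) q))"
    using fr assms by (intro smooth_function_sum smooth_function_mult on_frame) auto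
  ultimately show "\<exists>\<psi>. SF \<psi> \<and> \<psi> p \<noteq> 0 \<and> SF (\<lambda>q. \<psi> q * \<Omega> X Y q)"
    using fr by (intro exI[of _ "\<lambda>q. \<phi> q * \<phi> q"]) simp
qed

text \<open>The covariant derivative \<open>(\<nabla>\<^sub>W \<omega>)(X,Y)\<close>.\<close>

definition \<Omega>_deriv :: "('a \<Rightarrow> 'e) \<Rightarrow> ('a \<Rightarrow> 'e) \<Rightarrow> ('a \<Rightarrow> 'e) \<Rightarrow> 'a \<Rightarrow> real" where
  "\<Omega>_deriv W X Y p = dir_deriv \<A> W (\<Omega> X Y) p - \<Omega> (D W X) Y p - \<Omega> X (D W Y) p"

lemma \<Omega>_deriv_swap:
  assumes "VF W" "VF X" "VF Y"
  shows "\<Omega>_deriv W Y X p = - \<Omega>_deriv W X Y p"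
proof -
  have "\<Omega> Y X = (\<lambda>p. (-1) * \<Omega> X Y p)" using \<Omega>_swap[of Y X] by (simp add: fun_eq_iff)
  then have "dir_deriv \<A> W (\<Omega> Y X) p = - dir_deriv \<A> W (\<Omega> X Y) p"
    using dir_deriv_mult[of "\<lambda>p. -1" "\<Omega> X Y" W p] assms by (simp add: dir_deriv_const)
  then show ?thesis by (simp add: \<Omega>_deriv_def \<Omega>_swap[of Y "D W X"] \<Omega>_swap[of "D W Y" X])
qed

lemma \<Omega>_deriv_add_direction:
  assumes "VF W" "VF W'" "VF X" "VF Y"
  shows "\<Omega>_deriv (\<lambda>q. W q + W' q) X Y p = \<Omega>_deriv W X Y p + \<Omega>_deriv W' X Y p"
  using assms by (simp add: \<Omega>_deriv_def dir_deriv_add_field D_add_left) (simp add: \<Omega>_def \<omega>_linear)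

lemma \<Omega>_deriv_add_right:
  assumes "VF W" "VF X" "VF Y" "VF Y'"
  shows "\<Omega>_deriv W X (\<lambda>q. Y q + Y' q) p = \<Omega>_deriv W X Y p + \<Omega>_deriv W X Y' p"
proof -
  have "\<Omega> X (\<lambda>q. Y q + Y' q) = (\<lambda>q. \<Omega> X Y q + \<Omega> X Y' q)" by (simp add: fun_eq_iff \<Omega>_def \<omega>_linear)
  then show ?thesis
    using assms by (simp add: \<Omega>_deriv_def dir_deriv_add D_add_right) (simp add: \<Omega>_def \<omega>_linear)
qed

lemma curvature_deriv_\<Omega>:
  assumes "VF W" "VF X" "VF Y" "VF Z"
  shows "curvature_deriv W X Y Z p
       = (2 * \<Omega>_deriv W X Y p) *\<^sub>R Z p + \<Omega>_deriv W X Z p *\<^sub>R Y p - \<Omega>_deriv W Y Z p *\<^sub>R X p"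
  using assms dir_deriv_mult[of "\<lambda>p. 2" "\<Omega> X Y" W p]
  by (simp add: curvature_deriv_def \<Omega>_deriv_def curvature_\<Omega> D_add_right D_diff_right D_scaleR_right
      dir_deriv_const algebra_simps)

text \<open>The second Bianchi identity, sorted by the four vectors.  The first Bianchi identity that it
  rests on holds because \<open>H(\<omega>)\<close> satisfies it for every 2-form \<open>\<omega>\<close>.\<close>

lemma bianchi_\<Omega>:
  assumes "VF W" "VF X" "VF Y" "VF Z"
  shows "(2 * (\<Omega>_deriv W X Y p + \<Omega>_deriv X Y W p + \<Omega>_deriv Y W X p)) *\<^sub>R Z p
    + (\<Omega>_deriv W X Z p - \<Omega>_deriv X W Z p) *\<^sub>R Y p
    + (\<Omega>_deriv X Y Z p - \<Omega>_deriv Y X Z p) *\<^sub>R W p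
    + (\<Omega>_deriv Y W Z p - \<Omega>_deriv W Y Z p) *\<^sub>R X p = 0"
proof -
  have "R X Y W q + R Y W X q + R W X Y q = 0" for q
    using assms \<Omega>_swap[of Y X q] \<Omega>_swap[of W Y q] \<Omega>_swap[of X W q]
    by (simp add: curvature_\<Omega> flip: scaleR_add_left scaleR_diff_left)
       (simp add: algebra_simps scaleR_2 flip: scaleR_scaleR)
  from second_bianchi[OF assms this] show ?thesis
    using assms by (simp add: curvature_deriv_\<Omega> algebra_simps)
qed

text \<open>It suffices to work with fields at the point \<open>p\<close>; vectors are realised by extending them to
  fields.  This is where the dimension enters: two vectors must leave a direction orthogonal to both.\<close>

lemma \<Omega>_deriv_zero:
  assumes VF: "VF W" "VF X" "VF Y"
  shows "\<Omega>_deriv W X Y p = 0"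
proof -
  have diag: "\<Omega>_deriv W X W p = 0" if VF: "VF W" "VF X" for W X
  proof -
    have "dim {W p, X p} \<le> card {W p, X p}" by (auto intro!: dim_le_card span_base)
    also have "\<dots> \<le> 2" by (simp add: card_insert_if)
    finally obtain y where y: "y \<noteq> 0" "\<And>x. x \<in> span {W p, X p} \<Longrightarrow> orthogonal y x"
      using orthogonal_to_subspace_exists[of "{W p, X p}"] dim by auto
    have "W p \<in> span {W p, X p}" "X p \<in> span {W p, X p}" by (rule span_base, simp)+
    from this[THEN y(2)] have orth: "W p \<bullet> y = 0" "X p \<bullet> y = 0"
      by (auto simp: orthogonal_def inner_commute)
    define Y where "Y = field_extension \<A> p y"
    have Y: "VF Y" "Y p = y" by (simp_all add: Y_def field_extension_properties)
    have "\<Omega>_deriv X W W p = 0" using \<Omega>_deriv_swap[of X W W p] VF by simp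
    \<comment> \<open>The inner product with \<open>y\<close> of the relation for \<open>Z = W\<close>: only the coefficient of \<open>Y\<close> survives.\<close>
    then have "\<Omega>_deriv W X W p * (y \<bullet> y) = 0"
      using arg_cong[OF bianchi_\<Omega>[OF VF Y(1) VF(1), of p], of "\<lambda>v. v \<bullet> y"] orth
      by (simp add: inner_add_left Y(2))
    with y(1) show ?thesis by simp
  qed
  \<comment> \<open>Polarisation of the diagonal case, which together with antisymmetry in the last two slots makes
    \<open>\<nabla>\<omega>\<close> totally antisymmetric.\<close>
  have swap13: "\<Omega>_deriv Y X W p = - \<Omega>_deriv W X Y p" if "VF W" "VF X" "VF Y" for W X Y
    using that diag[of "\<lambda>q. W q + Y q" X] diag[of W X] diag[of Y X]
    by (simp add: \<Omega>_deriv_add_direction \<Omega>_deriv_add_right)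
  have nonzero: "\<Omega>_deriv W X Y p = 0" if VF: "VF W" "VF X" "VF Y" and "Y p \<noteq> 0" for W X Y
  proof -
    have "\<Omega>_deriv X Y W p = \<Omega>_deriv W X Y p" "\<Omega>_deriv Y W X p = \<Omega>_deriv W X Y p"
      "\<Omega>_deriv X W Y p = - \<Omega>_deriv W X Y p" "\<Omega>_deriv X Y Y p = 0" "\<Omega>_deriv Y X Y p = 0"
      "\<Omega>_deriv Y W Y p = 0" "\<Omega>_deriv W Y Y p = 0"
      using VF swap13[of W X Y] swap13[of X Y W] swap13[of X W Y] \<Omega>_deriv_swap[of X W Y p]
        \<Omega>_deriv_swap[of W X Y p] \<Omega>_deriv_swap[of Y W X p] \<Omega>_deriv_swap[of X Y Y p]
        \<Omega>_deriv_swap[of W Y Y p] diag[of Y X] diag[of Y W] by auto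
    \<comment> \<open>The relation for \<open>Z = Y\<close>: the cyclic sum contributes \<open>2 * 3\<close>, the coefficient of \<open>Y\<close> another 2.\<close>
    then have "(8 * \<Omega>_deriv W X Y p) *\<^sub>R Y p = 0"
      using bianchi_\<Omega>[OF VF VF(3), of p] by (simp flip: scaleR_add_left)
    with \<open>Y p \<noteq> 0\<close> show ?thesis by simp
  qed
  show ?thesis
  proof (cases "Y p = 0")
    case True
    \<comment> \<open>A field that vanishes at \<open>p\<close> is a difference of two fields that do not.\<close>
    obtain b :: 'e where "b \<noteq> 0" using nonzero_Basis nonempty_Basis by blast
    define B where "B = field_extension \<A> p b"
    have "VF B" "B p \<noteq> 0" using \<open>b \<noteq> 0\<close> by (simp_all add: B_def field_extension_properties)
    then show ?thesis
      using True VF nonzero[of W X B] nonzero[of W X "\<lambda>q. Y q + B q"] by (simp add: \<Omega>_deriv_add_right)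
  qed (use nonzero VF in blast)
qed

text \<open>The commutator of two covariant derivatives annihilates the parallel form \<open>\<omega>\<close>, so \<open>R\<close> acts on
  \<open>\<omega>\<close> trivially.\<close>

lemma curvature_annihilates_\<Omega>:
  assumes VF: "VF U" "VF V" "VF X" "VF Y"
  shows "\<Omega> (R U V X) Y p + \<Omega> X (R U V Y) p = 0"
proof -
  have d: "dir_deriv \<A> W (\<Omega> X Y) = (\<lambda>p. \<Omega> (D W X) Y p + \<Omega> X (D W Y) p)"
    if "VF W" "VF X" "VF Y" for W X Y
    using \<Omega>_deriv_zero[OF that] by (simp add: fun_eq_iff \<Omega>_deriv_def algebra_simps)
  have "dir_deriv \<A> (lie_bracket \<A> U V) (\<Omega> X Y) p
      = dir_deriv \<A> U (dir_deriv \<A> V (\<Omega> X Y)) p - dir_deriv \<A> V (dir_deriv \<A> U (\<Omega> X Y)) p"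
    using VF by (simp add: dir_deriv_lie_bracket)
  then show ?thesis
    using VF
    by (simp add: d dir_deriv_add lie_bracket_eq curvature_eq D_diff_left)
       (simp add: \<Omega>_def \<omega>_linear algebra_simps)
qed

lemma flat: "flat_connection \<A> D"
  unfolding flat_connection_def
proof (intro allI impI, elim conjE)
  fix X Y Z p assume VF: "VF X" "VF Y" "VF Z"
  have zero: "\<Omega> X Y p = 0" if VF: "VF X" "VF Y" for X Y
  proof -
    have "\<Omega> X X p = 0" "\<Omega> Y Y p = 0" using \<Omega>_swap[of X X p] \<Omega>_swap[of Y Y p] by auto
    \<comment> \<open>The choice \<open>U = X\<close>, \<open>V = Y\<close>, after inserting the algebraic form of \<open>R\<close>.\<close>
    then have "6 * (\<Omega> X Y p * \<Omega> X Y p) = 0"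
      using curvature_annihilates_\<Omega>[OF VF VF, of p] \<Omega>_swap[of Y X p] VF
      by (simp add: curvature_\<Omega>) (simp add: \<Omega>_def \<omega>_linear algebra_simps)
    then show ?thesis by simp
  qed
  show "R X Y Z p = 0" using VF by (simp add: curvature_\<Omega> zero)
qed

end

section \<open>Vector spaces as manifolds, and the theorem\<close>

lemma smooth_atlas_vector_space: "smooth_atlas (vector_space_atlas :: ('v::euclidean_space, 'v) chart set)"
proof -
  let ?c = "Chart UNIV id :: ('v, 'v) chart"
  have "param ?c = id" by (simp add: param_def)
  then show ?thesis
    by (simp add: smooth_atlas_def vector_space_atlas_def is_chart_def chart_image_def transition_def
        homeomorphism_ident id_def comp_def smooth_on_ident)
qed

theorem theorem1p8:
  fixes \<A> :: "('a::{t2_space,second_countable_topology}, 'e::euclidean_space) chart set"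
    and D :: "('a \<Rightarrow> 'e) \<Rightarrow> ('a \<Rightarrow> 'e) \<Rightarrow> 'a \<Rightarrow> 'e"
    and A :: "'v::euclidean_space \<Rightarrow> 'v \<Rightarrow> 'v \<Rightarrow> 'v"
  shows "(DIM('e) \<ge> 3 \<and> smooth_atlas \<A> \<and> connection \<A> D \<and> torsion_free \<A> D \<and>
            projectively_flat_connection \<A> D \<and> ricci_antisymmetric_connection \<A> D
          \<longrightarrow> flat_connection \<A> D)
       \<and> (DIM('v) \<ge> 3 \<and> A \<in> generalized_curvature_operators \<and> A \<noteq> (\<lambda>x y z. 0) \<and>
            projectively_flat A \<and> ricci_antisymmetric A
          \<longrightarrow> \<not> (\<exists>D'. connection vector_space_atlas D' \<and> torsion_free vector_space_atlas D' \<and>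
                     projectively_flat_connection vector_space_atlas D' \<and>
                     ricci_antisymmetric_connection vector_space_atlas D' \<and>
                     curvature_at vector_space_atlas D' 0 = A))"
proof (intro conjI impI notI, goal_cases)
  case 1
  then interpret projectively_flat_antisymmetric_connection \<A> D by unfold_locales auto
  show ?case by (rule flat)
next
  case 2
  then obtain D' where D': "connection vector_space_atlas D'" "torsion_free vector_space_atlas D'"
    "projectively_flat_connection vector_space_atlas D'"
    "ricci_antisymmetric_connection vector_space_atlas D'"
    "curvature_at vector_space_atlas D' 0 = A" by blast
  interpret projectively_flat_antisymmetric_connection vector_space_atlas D'
    using 2 D' smooth_atlas_vector_space by unfold_locales auto
  have "A = (\<lambda>x y z. 0)"
    using flat field_extension_properties
    by (simp add: fun_eq_iff flat_connection_def curvature_at_def flip: D'(5))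
  with 2 show ?case by blast
qed

end
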